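(* Let $(\mathcal Q,\|\cdot\|_{\mathcal Q})$ be a normed ideal of $m$-homogeneous scalar-valued polynomials, and let $j:Y\hookrightarrow X$ be an embedding of Banach spaces. If $q\in\mathcal Q(Y)$ admits a symmetric local extension to $\mathcal Q(X)$, then there exists $\widetilde q\in\mathcal Q^{\max}(X)$ extending $q$, i.e. $\widetilde q\circ j=q$.
   Context: $\mathbb K$ is the scalar field and $\mathcal P^m(E)$ is the space of continuous $m$-homogeneous scalar-valued polynomials on the Banach space $E$. A normed ideal of $m$-homogeneous polynomials is a subclass $\mathcal Q$ of the class of all continuous $m$-homogeneous scalar-valued polynomials on Banach spaces, together with $\|\cdot\|_{\mathcal Q}:\mathcal Q\to[0,\infty)$, such that, with $\mathcal Q(E)=\mathcal Q\cap\mathcal P^m(E)$: (1) $\mathcal Q(E)$ is a linear subspace of $\mathcal P^m(E)$ and $\|\cdot\|_{\mathcal Q}$ is a norm on it; (2) if $T:E\to F$ is bounded linear and $q\in\mathcal Q(F)$ then $q\circ T\in\mathcal Q(E)$ and $\|q\circ T\|_{\mathcal Q}\le\|T\|^m\|q\|_{\mathcal Q}$; (3) the polynomial $\mathbb K\ni z\mapsto z^m$ belongs to $\mathcal Q$ and has $\mathcal Q$-norm $1$. For $q\in\mathcal P^m(E)$ put $\|q\|_{\mathcal Q^{\max}}=\sup\{\|q|_M\|_{\mathcal Q}: M\subseteq E\text{ a finite-dimensional subspace}\}\in[0,\infty]$; the maximal envelope is $\mathcal Q^{\max}(E)=\{q\in\mathcal P^m(E):\|q\|_{\mathcal Q^{\max}}<\infty\}$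 with this norm. $q\in\mathcal Q(Y)$ admits a symmetric local extension to $\mathcal Q(X)$ (through $j$) if there is a constant $\lambda$ such that for all finite-dimensional subspaces $E\subseteq Y$ and $F\subseteq X$, the restriction $q|_E$ admits an extension $\widehat q\in\mathcal Q(j(E)+F)$ (i.e. $\widehat q(j(e))=q(e)$ for $e\in E$) with $\|\widehat q\|_{\mathcal Q}\le\lambda\|q|_E\|_{\mathcal Q}$. *)

theory Defs
  imports "HOL-Analysis.Analysis" "HOL-Algebra.Module" "HOL-Algebra.AbelCoset"
begin

section \<open>Normed spaces with an explicit carrier\<close>

text \<open>
  An ideal of polynomials ranges over all Banach spaces and over all their finite-dimensional
  subspaces, so spaces are records with a carrier set and not types. The scalar field is a type
  \<open>'k\<close> of sort \<open>{real_normed_field, heine_borel}\<close>; the types \<open>real\<close> and \<open>complex\<close> are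
  instances, and up to isometric isomorphism they are the only ones.

  The fields \<open>mult\<close> and \<open>one\<close> that the record \<open>module\<close> inherits from \<open>ring\<close> play no role.
\<close>

definition scalars :: "'k::{real_normed_field,heine_borel} ring" where
  "scalars = \<lparr>carrier = UNIV, mult = (*), one = 1, zero = 0, add = (+)\<rparr>"

record ('k, 'v) nspace = "('k, 'v) module" +
  vnorm :: "'v \<Rightarrow> real"

locale normed_space = Module.module scalars E
  for E :: "('k::{real_normed_field,heine_borel}, 'v) nspace" (structure) +
  assumes vnorm_nonneg: "x \<in> carrier E \<Longrightarrow> 0 \<le> vnorm E x"
    and vnorm_eq_0: "x \<in> carrier E \<Longrightarrow> vnorm E x = 0 \<longleftrightarrow> x = \<zero>"
    and vnorm_smult: "x \<in> carrier E \<Longrightarrow> vnorm E (c \<odot> x) = norm c * vnorm E x"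
    and vnorm_triangle:
      "\<lbrakk>x \<in> carrier E; y \<in> carrier E\<rbrakk> \<Longrightarrow> vnorm E (x \<oplus> y) \<le> vnorm E x + vnorm E y"

text \<open>
  The locale \<open>Metric_space\<close> wants a symmetric and nonnegative function on the whole type, hence
  the value 0 outside the carrier.
\<close>

definition vdist :: "('k, 'v) nspace \<Rightarrow> 'v \<Rightarrow> 'v \<Rightarrow> real" where
  "vdist E x y =
     (if x \<in> carrier E \<and> y \<in> carrier E then vnorm E (x \<ominus>\<^bsub>E\<^esub> y) else 0)"

definition norm_topology :: "('k, 'v) nspace \<Rightarrow> 'v topology" where
  "norm_topology E = Metric_space.mtopology (carrier E) (vdist E)"

locale banach_space = normed_space +
  assumes complete: "Metric_space.mcomplete (carrier E) (vdist E)"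

definition linear_op ::
  "('k::{real_normed_field,heine_borel}, 'v) nspace \<Rightarrow> ('k, 'w) nspace \<Rightarrow> ('v \<Rightarrow> 'w) \<Rightarrow> bool" where
  "linear_op E F T \<longleftrightarrow>
     T \<in> carrier E \<rightarrow> carrier F \<and>
     (\<forall>x\<in>carrier E. \<forall>y\<in>carrier E. T (x \<oplus>\<^bsub>E\<^esub> y) = T x \<oplus>\<^bsub>F\<^esub> T y) \<and>
     (\<forall>c. \<forall>x\<in>carrier E. T (c \<odot>\<^bsub>E\<^esub> x) = c \<odot>\<^bsub>F\<^esub> T x)"

definition bounded_op ::
  "('k::{real_normed_field,heine_borel}, 'v) nspace \<Rightarrow> ('k, 'w) nspace \<Rightarrow> ('v \<Rightarrow> 'w) \<Rightarrow> bool" where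
  "bounded_op E F T \<longleftrightarrow>
     linear_op E F T \<and> (\<exists>C. \<forall>x\<in>carrier E. vnorm F (T x) \<le> C * vnorm E x)"

definition op_norm :: "('k, 'v) nspace \<Rightarrow> ('k, 'w) nspace \<Rightarrow> ('v \<Rightarrow> 'w) \<Rightarrow> real" where
  "op_norm E F T = (SUP x\<in>{x \<in> carrier E. vnorm E x \<le> 1}. vnorm F (T x))"

definition linear_embedding ::
  "('k::{real_normed_field,heine_borel}, 'v) nspace \<Rightarrow> ('k, 'w) nspace \<Rightarrow> ('v \<Rightarrow> 'w) \<Rightarrow> bool" where
  "linear_embedding E F T \<longleftrightarrow>
     linear_op E F T \<and> embedding_map (norm_topology E) (norm_topology F) T"

text \<open>The subspace of \<open>E\<close> with underlying set \<open>S\<close>, with the norm of \<open>E\<close>.\<close>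

abbreviation subsp :: "('k, 'v) nspace \<Rightarrow> 'v set \<Rightarrow> ('k, 'v) nspace" where
  "subsp E S \<equiv> E\<lparr>carrier := S\<rparr>"

definition finite_dim :: "('k, 'v) nspace \<Rightarrow> bool" where
  "finite_dim E \<longleftrightarrow>
     (\<exists>B. finite B \<and> B \<subseteq> carrier E \<and>
        (\<forall>x\<in>carrier E. \<exists>c. x = (\<Oplus>\<^bsub>E\<^esub>b\<in>B. c b \<odot>\<^bsub>E\<^esub> b)))"

definition fd_subspaces :: "('k::{real_normed_field,heine_borel}, 'v) nspace \<Rightarrow> 'v set set" where
  "fd_subspaces E = {S. submodule S scalars E \<and> finite_dim (subsp E S)}"


section \<open>Continuous homogeneous polynomials\<close>

definition multilinear_form ::
  "nat \<Rightarrow> ('k::{real_normed_field,heine_borel}, 'v) nspace \<Rightarrow> ((nat \<Rightarrow> 'v) \<Rightarrow> 'k) \<Rightarrow> bool" where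
  "multilinear_form m E A \<longleftrightarrow>
     (\<forall>v \<in> {..<m} \<rightarrow>\<^sub>E carrier E. \<forall>i<m.
        (\<forall>x\<in>carrier E. \<forall>y\<in>carrier E. A (v(i := x \<oplus>\<^bsub>E\<^esub> y)) = A (v(i := x)) + A (v(i := y))) \<and>
        (\<forall>c. \<forall>x\<in>carrier E. A (v(i := c \<odot>\<^bsub>E\<^esub> x)) = c * A (v(i := x))))"

definition continuous_polynomial ::
  "nat \<Rightarrow> ('k::{real_normed_field,heine_borel}, 'v) nspace \<Rightarrow> ('v \<Rightarrow> 'k) \<Rightarrow> bool" where
  "continuous_polynomial m E q \<longleftrightarrow>
     (\<exists>A. multilinear_form m E A \<and> (\<forall>x\<in>carrier E. q x = A (\<lambda>i\<in>{..<m}. x))) \<and>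
     continuous_map (norm_topology E) euclidean q"

text \<open>
  The space \<open>P\<^sup>m(E)\<close>, as a vector space with pointwise operations. Polynomials on \<open>E\<close> are
  functions that are \<open>undefined\<close> outside \<open>carrier E\<close>, so that \<open>restrict q S\<close> and
  \<open>compose (carrier E) q T\<close> are the restriction of \<open>q\<close> to \<open>S\<close> and \<open>q \<circ> T\<close>. No norm is attached:
  the field \<open>vnorm\<close> is filled in by the ideal.
\<close>

definition polynomials ::
  "nat \<Rightarrow> ('k::{real_normed_field,heine_borel}, 'v) nspace \<Rightarrow> ('k, 'v \<Rightarrow> 'k) nspace" where
  "polynomials m E =
     \<lparr>carrier = {q \<in> extensional (carrier E). continuous_polynomial m E q},
      mult = undefined, one = undefined,
      zero = (\<lambda>x\<in>carrier E. 0),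
      add = (\<lambda>p q. \<lambda>x\<in>carrier E. p x + q x),
      smult = (\<lambda>c q. \<lambda>x\<in>carrier E. c * q x),
      vnorm = undefined\<rparr>"


section \<open>Normed ideals of polynomials\<close>

text \<open>
  The class of all Banach spaces is rendered as all Banach spaces whose carrier is a subset of
  \<open>'k + 'u\<close>, for an arbitrary type \<open>'u\<close>. The summand \<open>'k\<close> makes the scalar field itself
  one of these spaces. A polynomial on \<open>E\<close> belongs to the ideal iff it is an element of \<open>Q E\<close>;
  its norm in the ideal is \<open>N E q\<close>.
\<close>

definition scalar_space :: "('k::{real_normed_field,heine_borel}, 'k + 'u) nspace" where
  "scalar_space =
     \<lparr>carrier = range Inl,
      mult = undefined, one = undefined,
      zero = Inl 0,
      add = (\<lambda>x y. Inl (projl x + projl y)),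
      smult = (\<lambda>c x. Inl (c * projl x)),
      vnorm = (\<lambda>x. norm (projl x))\<rparr>"

locale normed_ideal =
  fixes m :: nat
    and Q :: "('k::{real_normed_field,heine_borel}, 'k + 'u) nspace \<Rightarrow> ('k + 'u \<Rightarrow> 'k) set"
    and N :: "('k, 'k + 'u) nspace \<Rightarrow> ('k + 'u \<Rightarrow> 'k) \<Rightarrow> real"
  assumes subspace: "banach_space E \<Longrightarrow> submodule (Q E) scalars (polynomials m E)"
    and norm: "banach_space E \<Longrightarrow> normed_space ((polynomials m E)\<lparr>carrier := Q E, vnorm := N E\<rparr>)"
    and compose_mem:
      "\<lbrakk>banach_space E; banach_space F; bounded_op E F T; q \<in> Q F\<rbrakk>
        \<Longrightarrow> compose (carrier E) q T \<in> Q E"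
    and compose_norm:
      "\<lbrakk>banach_space E; banach_space F; bounded_op E F T; q \<in> Q F\<rbrakk>
        \<Longrightarrow> N E (compose (carrier E) q T) \<le> op_norm E F T ^ m * N F q"
    and power_mem: "(\<lambda>z\<in>carrier scalar_space. projl z ^ m) \<in> Q scalar_space"
    and power_norm: "N scalar_space (\<lambda>z\<in>carrier scalar_space. projl z ^ m) = 1"

text \<open>
  On a finite-dimensional \<open>M\<close> every polynomial is a linear combination of \<open>m\<close>-th powers of
  functionals, so \<open>Q M\<close> contains all of \<open>P\<^sup>m(M)\<close> and the norms in the supremum are defined.
\<close>

definition max_norm ::
  "(('k::{real_normed_field,heine_borel}, 'v) nspace \<Rightarrow> ('v \<Rightarrow> 'k) \<Rightarrow> real)
     \<Rightarrow> ('k, 'v) nspace \<Rightarrow> ('v \<Rightarrow> 'k) \<Rightarrow> ennreal" where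
  "max_norm N E q = (SUP M\<in>fd_subspaces E. ennreal (N (subsp E M) (restrict q M)))"

definition max_envelope ::
  "nat \<Rightarrow> (('k::{real_normed_field,heine_borel}, 'v) nspace \<Rightarrow> ('v \<Rightarrow> 'k) \<Rightarrow> real)
     \<Rightarrow> ('k, 'v) nspace \<Rightarrow> ('v \<Rightarrow> 'k) set" where
  "max_envelope m N E = {q \<in> carrier (polynomials m E). max_norm N E q < \<infinity>}"

definition symmetric_local_extension ::
  "(('k::{real_normed_field,heine_borel}, 'v) nspace \<Rightarrow> ('v \<Rightarrow> 'k) set)
     \<Rightarrow> (('k, 'v) nspace \<Rightarrow> ('v \<Rightarrow> 'k) \<Rightarrow> real)
     \<Rightarrow> ('k, 'v) nspace \<Rightarrow> ('k, 'v) nspace \<Rightarrow> ('v \<Rightarrow> 'v) \<Rightarrow> ('v \<Rightarrow> 'k) \<Rightarrow> bool" where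
  "symmetric_local_extension Q N Y X j q \<longleftrightarrow>
     (\<exists>C. \<forall>E\<in>fd_subspaces Y. \<forall>F\<in>fd_subspaces X.
        \<exists>q'\<in>Q (subsp X (j ` E <+>\<^bsub>X\<^esub> F)).
          (\<forall>e\<in>E. q' (j e) = q e) \<and>
          N (subsp X (j ` E <+>\<^bsub>X\<^esub> F)) q' \<le> C * N (subsp Y E) (restrict q E))"

end

theory Submission
  imports Defs
begin

text \<open>
  The extension is obtained by compactness, in the topology of pointwise convergence, from the local
  extensions that the hypothesis provides. For a finite-dimensional \<open>E \<subseteq> Y\<close> and a finite-dimensional \<open>F \<subseteq> X\<close> there is an
  extension \<open>p\<close> of \<open>q\<bar>E\<close> to \<open>M = j(E) + F\<close> with \<open>\<parallel>p\<parallel> \<le> C \<parallel>q\<bar>E\<parallel> \<le> R\<close>, where \<open>R = \<bar>C\<bar> \<parallel>q\<parallel>\<close>; the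
  second inequality is the ideal property for the inclusion \<open>E \<subseteq> Y\<close> (\<open>restrict_mem_norm\<close>). The ideal
  property for the operator \<open>z \<mapsto> z x\<close> from the scalar field to \<open>M\<close> gives the pointwise bound
  \<open>\<bar>p(x)\<bar> \<le> R \<parallel>x\<parallel>\<^sup>m\<close> (\<open>norm_eval_le\<close>). After extension by zero, all these \<open>p\<close> lie in one product of
  closed balls of the scalar field, which is compact by Tychonoff's theorem. A function \<open>f\<close> in this
  product is a solution if it satisfies, for every finite-dimensional \<open>M \<subseteq> X\<close> and every \<open>y \<in> Y\<close>,

    \<^item> \<open>f\<bar>M\<close> belongs to the ideal and has norm at most \<open>R\<close>;
    \<^item> \<open>f(j(y)) = q(y)\<close>.

  Finitely many of these conditions concern one pair \<open>(E, F)\<close> only and are met by its \<open>p\<close>; so the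
  finite intersection property gives a solution as soon as every condition is closed for pointwise
  convergence.

  For the first condition this is \<open>closed_norm_le\<close>. On a finite-dimensional \<open>M\<close> the \<open>m\<close>-homogeneous
  polynomials are combinations of finitely many fixed functions. Such a space of functions is
  determined by its values at finitely many points, by an interpolation formula
  \<open>p = (\<Sum>s\<in>S. p(s) L\<^sub>s)\<close> with all \<open>L\<^sub>s\<close> in the space (\<open>evaluation_basis\<close>). The formula passes to
  pointwise limits and makes the ideal norm a continuous function of the values at \<open>S\<close>.

  A solution \<open>f\<close> has \<open>\<parallel>f\<parallel> \<le> R\<close> in the maximal envelope by the first condition. What remains is that it is
  a continuous polynomial on all of \<open>X\<close>, although it is known to be a polynomial only on the
  finite-dimensional subspaces. The polarization formula expresses a symmetric multilinear form
  through the polynomial alone, so that the forms on the various subspaces agree and define one form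
  on \<open>X\<close>; the bound \<open>\<bar>f(x)\<bar> \<le> R \<parallel>x\<parallel>\<^sup>m\<close> carries over to this form and yields continuity
  (\<open>continuous_polynomial_if_locally\<close>).

  The axioms of a normed ideal speak about Banach spaces, and applying them to subspaces \<open>M\<close>
  uses that finite-dimensional normed spaces are complete (\<open>banach_space_fd\<close>).
\<close>

section \<open>Subspaces and finite linear spans\<close>

lemma scalars_simps [simp]:
  "carrier scalars = UNIV" "a \<otimes>\<^bsub>scalars\<^esub> b = a * b" "a \<oplus>\<^bsub>scalars\<^esub> b = a + b"
  "\<zero>\<^bsub>scalars\<^esub> = 0" "\<one>\<^bsub>scalars\<^esub> = 1"
  by (simp_all add: scalars_def)

lemma cring_scalars: "cring (scalars :: 'k::{real_normed_field,heine_borel} ring)"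
proof (rule cringI)
  show "abelian_group (scalars :: 'k ring)"
    by (rule abelian_groupI) (auto simp: algebra_simps intro: exI[of _ "- x" for x])
  show "comm_monoid (scalars :: 'k ring)"
    by (rule comm_monoidI) auto
qed (simp add: algebra_simps)

lemma uminus_scalars [simp]: "\<ominus>\<^bsub>scalars\<^esub> a = - (a :: 'k::{real_normed_field,heine_borel})"
proof -
  interpret cring "scalars :: 'k ring" by (rule cring_scalars)
  have "\<ominus>\<^bsub>scalars\<^esub> a \<oplus>\<^bsub>scalars\<^esub> a = 0"
    using l_neg[of a] by simp
  then show ?thesis by (simp add: eq_neg_iff_add_eq_0)
qed

context normed_space
begin

lemma scal_closed [simp, intro]: "x \<in> carrier E \<Longrightarrow> c \<odot> x \<in> carrier E"
  using smult_closed[of c x] by simp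

lemma minus_eq_scal: "x \<in> carrier E \<Longrightarrow> \<ominus> x = (-1) \<odot> x"
  using smult_l_minus[of 1 x] smult_one[of x] by simp

lemma scal_add_left: "x \<in> carrier E \<Longrightarrow> (a + b) \<odot> x = a \<odot> x \<oplus> b \<odot> x"
  using smult_l_distr[of a b x] by simp

lemma scal_add_right: "x \<in> carrier E \<Longrightarrow> y \<in> carrier E \<Longrightarrow> a \<odot> (x \<oplus> y) = a \<odot> x \<oplus> a \<odot> y"
  using smult_r_distr[of a x y] by simp

lemma scal_scal: "x \<in> carrier E \<Longrightarrow> a \<odot> (b \<odot> x) = (a * b) \<odot> x"
  using smult_assoc1[of a b x] by simp

lemma scal_one [simp]: "x \<in> carrier E \<Longrightarrow> 1 \<odot> x = x"
  using smult_one[of x] by simp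

lemma scal_zero_left [simp]: "x \<in> carrier E \<Longrightarrow> 0 \<odot> x = \<zero>"
  using smult_l_null[of x] by simp

lemma scal_zero_right [simp]: "a \<odot> \<zero> = \<zero>"
  using smult_r_null[of a] by simp

lemma vnorm_zero [simp]: "vnorm E \<zero> = 0"
  using vnorm_eq_0[of \<zero>] by simp

lemma diff_eq_scal: "x \<in> carrier E \<Longrightarrow> y \<in> carrier E \<Longrightarrow> x \<ominus> y = x \<oplus> (-1) \<odot> y"
  by (simp add: a_minus_def minus_eq_scal)

lemma vnorm_minus: "x \<in> carrier E \<Longrightarrow> vnorm E (\<ominus> x) = vnorm E x"
  by (simp add: minus_eq_scal vnorm_smult)

lemma vnorm_diff_commute:
  assumes "x \<in> carrier E" "y \<in> carrier E"
  shows "vnorm E (x \<ominus> y) = vnorm E (y \<ominus> x)"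
proof -
  have "y \<ominus> x = \<ominus> (x \<ominus> y)"
    using assms by (simp add: a_minus_def minus_add minus_minus a_comm)
  then show ?thesis using assms by (simp add: vnorm_minus)
qed

lemma diff_add_diff:
  assumes "x \<in> carrier E" "y \<in> carrier E" "z \<in> carrier E"
  shows "(x \<ominus> y) \<oplus> (y \<ominus> z) = x \<ominus> z"
  using assms by (simp add: a_minus_def a_assoc r_neg1 r_neg2)

lemma diff_eq_zero_iff:
  assumes "x \<in> carrier E" "y \<in> carrier E"
  shows "x \<ominus> y = \<zero> \<longleftrightarrow> x = y"
  using assms by (metis a_minus_def add.inv_closed minus_equality minus_minus r_neg)

lemma Metric_space_vdist: "Metric_space (carrier E) (vdist E)"
proof
  fix x y z
  show "0 \<le> vdist E x y" by (simp add: vdist_def vnorm_nonneg)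
  show "vdist E x y = vdist E y x" by (simp add: vdist_def vnorm_diff_commute)
  show "x \<in> carrier E \<Longrightarrow> y \<in> carrier E \<Longrightarrow> vdist E x y = 0 \<longleftrightarrow> x = y"
    by (simp add: vdist_def vnorm_eq_0 diff_eq_zero_iff)
  show "vdist E x z \<le> vdist E x y + vdist E y z"
    if "x \<in> carrier E" "y \<in> carrier E" "z \<in> carrier E"
    using vnorm_triangle[of "x \<ominus> y" "y \<ominus> z"] that by (simp add: vdist_def diff_add_diff)
qed

lemma subspI:
  assumes "S \<subseteq> carrier E" "\<zero> \<in> S" "\<And>x y. x \<in> S \<Longrightarrow> y \<in> S \<Longrightarrow> x \<oplus> y \<in> S"
    "\<And>c x. x \<in> S \<Longrightarrow> c \<odot> x \<in> S"
  shows "submodule S scalars E"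
  using assms minus_eq_scal by (intro submoduleI) (simp_all add: subset_iff)

lemma subspD:
  assumes "submodule S scalars E"
  shows "S \<subseteq> carrier E" "\<zero> \<in> S" "\<And>x y. x \<in> S \<Longrightarrow> y \<in> S \<Longrightarrow> x \<oplus> y \<in> S"
    "\<And>c x. x \<in> S \<Longrightarrow> c \<odot> x \<in> S"
    "\<And>x y. x \<in> S \<Longrightarrow> y \<in> S \<Longrightarrow> x \<ominus> y \<in> S"
  using submoduleE[OF assms] subgroup.one_closed[OF submodule.axioms(1)[OF assms]]
  by (simp_all add: a_minus_def)

text \<open>
  The inverse in a group record is the unique inverse within its carrier, so shrinking the carrier
  could change it a priori.
\<close>

lemma a_minus_subsp:
  assumes "submodule S scalars E" "x \<in> S" "y \<in> S"
  shows "x \<ominus>\<^bsub>subsp E S\<^esub> y = x \<ominus> y"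
proof -
  have "inv\<^bsub>(add_monoid E)\<lparr>carrier := S\<rparr>\<^esub> y = inv\<^bsub>add_monoid E\<^esub> y"
    by (rule group.m_inv_consistent[OF a_group submodule.axioms(1)[OF assms(1)] assms(3)])
  then show ?thesis by (simp add: a_minus_def a_inv_def)
qed

lemma normed_space_subsp:
  assumes "submodule S scalars E"
  shows "normed_space (subsp E S)"
proof -
  have S: "S \<subseteq> carrier E" using subspD(1)[OF assms] .
  have "Module.module scalars (subsp E S)"
    using submodule.submodule_is_module[OF assms] module_axioms by simp
  then show ?thesis
    using S by (auto simp: normed_space_def normed_space_axioms_def vnorm_nonneg vnorm_eq_0
        vnorm_smult vnorm_triangle subset_iff)
qed

lemma vdist_subsp:
  assumes "submodule S scalars E" "x \<in> S" "y \<in> S"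
  shows "vdist (subsp E S) x y = vdist E x y"
  using assms subspD(1)[OF assms(1)] by (auto simp: vdist_def a_minus_subsp)

lemma finsum_mem_subsp:
  assumes S: "submodule S scalars E" and "f \<in> A \<rightarrow> S"
  shows "finsum E f A \<in> S"
  using assms(2)
proof (induction A rule: infinite_finite_induct)
  case (insert a A)
  have "f a \<in> S" "f \<in> A \<rightarrow> S" using insert.prems by auto
  moreover have "f a \<in> carrier E" "f \<in> A \<rightarrow> carrier E"
    using calculation subspD(1)[OF S] by auto
  ultimately show ?case
    using insert subspD(3)[OF S] by (simp add: finsum_insert)
qed (use subspD(2)[OF S] in \<open>simp_all add: finsum_infinite\<close>)

lemma finsum_subsp:
  assumes S: "submodule S scalars E" and "f \<in> A \<rightarrow> S"
  shows "finsum (subsp E S) f A = finsum E f A"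
proof -
  interpret S: normed_space "subsp E S" by (rule normed_space_subsp[OF S])
  show ?thesis
    using assms(2)
  proof (induction A rule: infinite_finite_induct)
    case (infinite A)
    then show ?case using S.finsum_infinite[of A f] finsum_infinite[of A f] by simp
  next
    case empty
    show ?case using S.finsum_empty[of f] by simp
  next
    case (insert a A)
    have f: "f a \<in> S" "f \<in> A \<rightarrow> S" using insert.prems by auto
    then have fE: "f a \<in> carrier E" "f \<in> A \<rightarrow> carrier E"
      using subspD(1)[OF S] by auto
    show ?case
      using insert f fE S.finsum_insert[of A a f] by (simp add: finsum_insert)
  qed
qed

definition lin_span :: "'v set \<Rightarrow> 'v set" where
  "lin_span B = {\<Oplus>b\<in>B. c b \<odot> b |c. True}"

lemma lin_span_least:
  assumes "submodule S scalars E" "B \<subseteq> S"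
  shows "lin_span B \<subseteq> S"
  using assms subspD(4)[OF assms(1)] by (auto simp: lin_span_def intro!: finsum_mem_subsp)

lemma submodule_lin_span:
  assumes B: "finite B" "B \<subseteq> carrier E"
  shows "submodule (lin_span B) scalars E"
proof (rule subspI)
  have cB: "(\<lambda>b. c b \<odot> b) \<in> B \<rightarrow> carrier E" for c :: "'v \<Rightarrow> 'k" using B by auto
  show "lin_span B \<subseteq> carrier E" using cB by (auto simp: lin_span_def intro!: finsum_closed)
  have "(\<Oplus>b\<in>B. 0 \<odot> b) = (\<Oplus>b\<in>B. \<zero>)"
    using B by (intro finsum_cong') auto
  then have "(\<Oplus>b\<in>B. 0 \<odot> b) = \<zero>" by (simp add: finsum_zero)
  then show "\<zero> \<in> lin_span B" by (auto simp: lin_span_def intro!: exI[of _ "\<lambda>_. 0"])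
  fix x y assume "x \<in> lin_span B" "y \<in> lin_span B"
  then obtain c d where "x = (\<Oplus>b\<in>B. c b \<odot> b)" "y = (\<Oplus>b\<in>B. d b \<odot> b)"
    by (auto simp: lin_span_def)
  then have "x \<oplus> y = (\<Oplus>b\<in>B. c b \<odot> b \<oplus> d b \<odot> b)" by (simp add: finsum_addf cB)
  also have "\<dots> = (\<Oplus>b\<in>B. (c b + d b) \<odot> b)"
    using B by (intro finsum_cong') (auto simp: scal_add_left)
  finally show "x \<oplus> y \<in> lin_span B" by (auto simp: lin_span_def intro!: exI[of _ "\<lambda>b. c b + d b"])
next
  fix a x assume "x \<in> lin_span B"
  then obtain c where "x = (\<Oplus>b\<in>B. c b \<odot> b)" by (auto simp: lin_span_def)
  then have "a \<odot> x = (\<Oplus>b\<in>B. a \<odot> (c b \<odot> b))"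
    using finsum_smult_ldistr[of B a "\<lambda>b. c b \<odot> b"] B by (auto simp: Pi_iff subset_iff)
  also have "\<dots> = (\<Oplus>b\<in>B. (a * c b) \<odot> b)"
    using B by (intro finsum_cong') (auto simp: scal_scal)
  finally show "a \<odot> x \<in> lin_span B" by (auto simp: lin_span_def intro!: exI[of _ "\<lambda>b. a * c b"])
qed

lemma lin_span_superset:
  assumes B: "finite B" "B \<subseteq> carrier E"
  shows "B \<subseteq> lin_span B"
proof
  fix x assume x: "x \<in> B"
  have "(\<Oplus>b\<in>B. (if b = x then 1 else 0) \<odot> b) = (\<Oplus>b\<in>B. if x = b then b else \<zero>)"
    using B by (intro finsum_cong') auto
  also have "\<dots> = x" using B x by (intro finsum_singleton) auto
  finally show "x \<in> lin_span B"
    unfolding lin_span_def by (intro CollectI exI[of _ "\<lambda>b. if b = x then 1 else 0"]) simp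
qed

lemma fd_subspaces_iff:
  "S \<in> fd_subspaces E \<longleftrightarrow> (\<exists>B. finite B \<and> B \<subseteq> carrier E \<and> S = lin_span B)"
proof
  assume "S \<in> fd_subspaces E"
  then have S: "submodule S scalars E" and "finite_dim (subsp E S)"
    by (auto simp: fd_subspaces_def)
  then obtain B where B: "finite B" "B \<subseteq> S"
    and spans: "\<And>x. x \<in> S \<Longrightarrow> \<exists>c. x = finsum (subsp E S) (\<lambda>b. c b \<odot> b) B"
    by (auto simp: finite_dim_def)
  have "S \<subseteq> lin_span B"
  proof
    fix x assume "x \<in> S"
    with spans obtain c where "x = finsum (subsp E S) (\<lambda>b. c b \<odot> b) B" by blast
    also have "\<dots> = (\<Oplus>b\<in>B. c b \<odot> b)"
      using B subspD(4)[OF S] by (intro finsum_subsp[OF S]) auto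
    finally show "x \<in> lin_span B" by (auto simp: lin_span_def)
  qed
  with lin_span_least[OF S B(2)] B subspD(1)[OF S]
  show "\<exists>B. finite B \<and> B \<subseteq> carrier E \<and> S = lin_span B" by blast
next
  assume "\<exists>B. finite B \<and> B \<subseteq> carrier E \<and> S = lin_span B"
  then obtain B where B: "finite B" "B \<subseteq> carrier E" and S: "S = lin_span B" by blast
  have sub: "submodule S scalars E" and BS: "B \<subseteq> S"
    using submodule_lin_span[OF B] lin_span_superset[OF B] S by auto
  have "\<exists>c. x = finsum (subsp E S) (\<lambda>b. c b \<odot> b) B" if x: "x \<in> S" for x
  proof -
    obtain c where "x = (\<Oplus>b\<in>B. c b \<odot> b)" using x by (auto simp: S lin_span_def)
    also have "\<dots> = finsum (subsp E S) (\<lambda>b. c b \<odot> b) B"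
      using BS subspD(4)[OF sub] by (intro finsum_subsp[OF sub, symmetric]) auto
    finally show ?thesis by blast
  qed
  then show "S \<in> fd_subspaces E"
    using sub BS B(1) by (auto simp: fd_subspaces_def finite_dim_def)
qed

text \<open>
  Being generated, as the least subspace that contains a given finite set, is easier to verify for sums and
  images than the existence of coefficients; this rule and the next translate between the two.
\<close>

lemma fd_subspacesI:
  assumes "submodule S scalars E" "finite B" "B \<subseteq> S"
    and "\<And>T. submodule T scalars E \<Longrightarrow> B \<subseteq> T \<Longrightarrow> S \<subseteq> T"
  shows "S \<in> fd_subspaces E"
proof -
  have "B \<subseteq> carrier E" using assms(3) subspD(1)[OF assms(1)] by blast
  then have "S = lin_span B"
    using assms lin_span_least submodule_lin_span lin_span_superset by (metis subset_antisym)
  then show ?thesis using \<open>B \<subseteq> carrier E\<close> assms(2) by (auto simp: fd_subspaces_iff)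
qed

lemma fd_subspacesE:
  assumes "S \<in> fd_subspaces E"
  obtains B where "finite B" "B \<subseteq> S"
    "\<And>T. submodule T scalars E \<Longrightarrow> B \<subseteq> T \<Longrightarrow> S \<subseteq> T"
  using assms lin_span_superset lin_span_least unfolding fd_subspaces_iff by metis

lemma fd_subspaces_submodule: "S \<in> fd_subspaces E \<Longrightarrow> submodule S scalars E"
  by (simp add: fd_subspaces_def)

lemma fd_subspaces_containing:
  assumes "finite B" "B \<subseteq> carrier E"
  shows "\<exists>S\<in>fd_subspaces E. B \<subseteq> S"
proof
  show "B \<subseteq> lin_span B" using assms by (rule lin_span_superset)
  show "lin_span B \<in> fd_subspaces E"
    using assms unfolding fd_subspaces_iff by (intro exI[of _ B]) simp
qed

end

section \<open>Finite-dimensional normed spaces are complete\<close>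

text \<open>
  In this form completeness visibly depends only on the values of \<open>d\<close> on \<open>S\<close>, so it can be moved between a
  subspace as a subset of \<open>E\<close> and the subspace as a space of its own.
\<close>

lemma mcomplete_iff_sequences:
  assumes "Metric_space S d"
  shows "Metric_space.mcomplete S d \<longleftrightarrow>
    (\<forall>\<sigma>. range \<sigma> \<subseteq> S \<longrightarrow> (\<forall>e>0. \<exists>n0. \<forall>n\<ge>n0. \<forall>k\<ge>n0. d (\<sigma> n) (\<sigma> k) < e) \<longrightarrow>
      (\<exists>x\<in>S. (\<lambda>n. d (\<sigma> n) x) \<longlonglongrightarrow> 0))"
proof -
  interpret Metric_space S d by fact
  have "(\<forall>\<^sub>F n in sequentially. \<sigma> n \<in> S) = True" if "range \<sigma> \<subseteq> S" for \<sigma>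
    using that by (auto intro: always_eventually)
  then show ?thesis
    unfolding mcomplete_def MCauchy_def limitin_metric_dist_null
    by (simp add: Bex_def cong: conj_cong) (simp add: imp_conjL)
qed

context normed_space
begin

lemma adjoin_diff:
  assumes "s \<in> carrier E" "t \<in> carrier E" "a \<in> carrier E"
  shows "(s \<oplus> c \<odot> a) \<ominus> (t \<oplus> b \<odot> a) = (s \<ominus> t) \<oplus> (c - b) \<odot> a"
proof -
  have "(s \<oplus> c \<odot> a) \<ominus> (t \<oplus> b \<odot> a) = (s \<oplus> c \<odot> a) \<oplus> ((-1) \<odot> t \<oplus> (- b) \<odot> a)"
    using assms by (simp add: diff_eq_scal scal_add_right scal_scal)
  also have "\<dots> = (s \<oplus> (-1) \<odot> t) \<oplus> (c \<odot> a \<oplus> (- b) \<odot> a)"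
    using assms by (simp add: a_ac)
  also have "c \<odot> a \<oplus> (- b) \<odot> a = (c - b) \<odot> a"
    using assms scal_add_left[of a c "- b"] by simp
  finally show ?thesis using assms by (simp add: diff_eq_scal)
qed

text \<open>
  A complete subspace is closed, so a vector outside it has a positive distance \<open>d\<close> from it. By
  homogeneity the coefficient of \<open>a\<close> is then controlled by the norm of the whole vector.
\<close>

lemma adjoin_coefficient_bound:
  assumes S: "submodule S scalars E" and comp: "Metric_space.mcomplete S (vdist E)"
    and a: "a \<in> carrier E" "a \<notin> S"
  obtains d where "d > 0" "\<And>s c. s \<in> S \<Longrightarrow> norm c * d \<le> vnorm E (s \<oplus> c \<odot> a)"
proof -
  interpret M: Metric_space "carrier E" "vdist E" by (rule Metric_space_vdist)
  have SE: "S \<subseteq> carrier E" by (rule subspD(1)[OF S])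
  interpret sub: Submetric "carrier E" "vdist E" S by standard (rule SE)
  \<comment> \<open>The radius of a ball around \<open>-a\<close> that misses \<open>S\<close> bounds the norms of the vectors \<open>s + a\<close> from below.\<close>
  have "closedin M.mtopology S" using comp sub.mcomplete_imp_closedin by blast
  moreover have "\<ominus> a \<in> carrier E - S"
    using a subspD(4)[OF S, of "\<ominus> a" "-1"] by (auto simp: minus_eq_scal scal_scal)
  ultimately obtain d where d: "d > 0" and disj: "disjnt S (M.mball (\<ominus> a) d)"
    unfolding M.closedin_metric by blast
  have far: "d \<le> vnorm E (s \<oplus> a)" if s: "s \<in> S" for s
  proof -
    have "\<not> vdist E (\<ominus> a) s < d" using disj s a SE by (auto simp: disjnt_iff)
    moreover have "vdist E (\<ominus> a) s = vnorm E (s \<oplus> a)"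
      using a s SE vnorm_diff_commute[of "\<ominus> a" s] by (auto simp: vdist_def a_minus_def minus_minus subset_iff)
    ultimately show ?thesis by simp
  qed
  have "norm c * d \<le> vnorm E (s \<oplus> c \<odot> a)" if s: "s \<in> S" for s c
  proof (cases "c = 0")
    case True
    then show ?thesis using s a SE by (auto intro: vnorm_nonneg)
  next
    case False
    have sE: "s \<in> carrier E" using s SE by blast
    have "s \<oplus> c \<odot> a = c \<odot> (inverse c \<odot> s \<oplus> a)"
      using sE a False by (simp add: scal_add_right scal_scal)
    then have "vnorm E (s \<oplus> c \<odot> a) = norm c * vnorm E (inverse c \<odot> s \<oplus> a)"
      using sE a by (simp add: vnorm_smult)
    then show ?thesis using far[OF subspD(4)[OF S s, of "inverse c"]] by (simp add: mult_left_mono)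
  qed
  with d that show thesis by blast
qed

text \<open>
  By the coefficient bound a Cauchy sequence \<open>s\<^sub>n + c\<^sub>n a\<close> has Cauchy coefficients \<open>c\<^sub>n\<close>, hence Cauchy
  components \<open>s\<^sub>n\<close>, and both converge separately.
\<close>

lemma mcomplete_adjoin:
  assumes S: "submodule S scalars E" and comp: "Metric_space.mcomplete S (vdist E)"
    and a: "a \<in> carrier E" "a \<notin> S"
  shows "Metric_space.mcomplete {s \<oplus> c \<odot> a |s c. s \<in> S} (vdist E)"
proof -
  have SE: "S \<subseteq> carrier E" by (rule subspD(1)[OF S])
  have metric: "Metric_space T (vdist E)" if "T \<subseteq> carrier E" for T
    using Metric_space.subspace[OF Metric_space_vdist that] .
  obtain d where d: "d > 0" "\<And>s c. s \<in> S \<Longrightarrow> norm c * d \<le> vnorm E (s \<oplus> c \<odot> a)"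
    using adjoin_coefficient_bound[OF assms] by blast
  have adj: "vdist E (s \<oplus> c \<odot> a) (t \<oplus> b \<odot> a) = vnorm E ((s \<ominus> t) \<oplus> (c - b) \<odot> a)"
    if "s \<in> S" "t \<in> S" for s t c b
    using that SE a adjoin_diff[of s t a c b] by (auto simp: vdist_def subset_iff)
  have TE: "{s \<oplus> c \<odot> a |s c. s \<in> S} \<subseteq> carrier E" using a SE by auto
  show ?thesis
    unfolding mcomplete_iff_sequences[OF metric[OF TE]]
  proof (intro allI impI)
    fix x :: "nat \<Rightarrow> 'v"
    assume "range x \<subseteq> {s \<oplus> c \<odot> a |s c. s \<in> S}"
      and Cauchy_x: "\<forall>e>0. \<exists>n0. \<forall>n\<ge>n0. \<forall>k\<ge>n0. vdist E (x n) (x k) < e"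
    then have "\<forall>n. \<exists>s c. s \<in> S \<and> x n = s \<oplus> c \<odot> a" by blast
    then obtain s c where s: "\<And>n. s n \<in> S" and x: "\<And>n. x n = s n \<oplus> c n \<odot> a" by metis
    have sE: "s n \<in> carrier E" for n using s SE by blast
    have c_le: "norm (c n - c k) * d \<le> vdist E (x n) (x k)" for n k
      unfolding x adj[OF s s] using d(2)[OF subspD(5)[OF S s s]] .
    have "Cauchy c"
    proof (rule metric_CauchyI)
      fix e :: real assume "e > 0"
      then obtain n0 where "\<forall>n\<ge>n0. \<forall>k\<ge>n0. vdist E (x n) (x k) < e * d"
        using Cauchy_x d(1) by (meson mult_pos_pos)
      then have "\<forall>n\<ge>n0. \<forall>k\<ge>n0. norm (c n - c k) * d < e * d"
        using c_le le_less_trans by blast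
      then show "\<exists>n0. \<forall>n\<ge>n0. \<forall>k\<ge>n0. dist (c n) (c k) < e"
        using d(1) by (auto simp: dist_norm)
    qed
    then obtain c' where c': "c \<longlonglongrightarrow> c'" using Cauchy_convergent_iff convergent_def by blast
    have s_le: "vdist E (s n) (s k) \<le> vdist E (x n) (x k) + norm (c n - c k) * vnorm E a" for n k
    proof -
      have "s n \<ominus> s k = ((s n \<ominus> s k) \<oplus> (c n - c k) \<odot> a) \<oplus> (- (c n - c k)) \<odot> a"
        using sE a scal_add_left[of a "c n - c k" "- (c n - c k)"]
        by (simp add: a_assoc del: minus_diff_eq)
      then have "vnorm E (s n \<ominus> s k) \<le>
          vnorm E ((s n \<ominus> s k) \<oplus> (c n - c k) \<odot> a) + vnorm E ((- (c n - c k)) \<odot> a)"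
        using sE a vnorm_triangle by (metis a_closed minus_closed scal_closed)
      then show ?thesis
        unfolding x adj[OF s s] using sE a by (simp add: vdist_def vnorm_smult norm_minus_commute)
    qed
    have "\<forall>e>0. \<exists>n0. \<forall>n\<ge>n0. \<forall>k\<ge>n0. vdist E (s n) (s k) < e"
    proof (intro allI impI)
      fix e :: real assume e: "e > 0"
      \<comment> \<open>The summand 1 avoids a division by zero; \<open>a = 0\<close> is not excluded at this point.\<close>
      define r where "r = (e / 2) / (vnorm E a + 1)"
      have na: "vnorm E a \<ge> 0" using a by (simp add: vnorm_nonneg)
      then have r: "r > 0" using e by (simp add: r_def)
      obtain n1 where n1: "\<forall>n\<ge>n1. \<forall>k\<ge>n1. vdist E (x n) (x k) < e/2"
        using Cauchy_x e by (meson half_gt_zero)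
      obtain n2 where n2: "\<forall>n\<ge>n2. \<forall>k\<ge>n2. norm (c n - c k) < r"
        using \<open>Cauchy c\<close> r unfolding Cauchy_def dist_norm by blast
      have "vdist E (s n) (s k) < e" if "n \<ge> max n1 n2" "k \<ge> max n1 n2" for n k
      proof -
        have "norm (c n - c k) * vnorm E a \<le> r * (vnorm E a + 1)"
          using n2 that na r by (intro mult_mono) (auto intro: less_imp_le)
        also have "\<dots> = e / 2"
          using na unfolding r_def times_divide_eq_left[of _ "vnorm E a + 1"]
          by (intro nonzero_mult_div_cancel_right) simp
        moreover have "vdist E (x n) (x k) < e/2" using n1 that by simp
        ultimately show ?thesis using s_le[of n k] by linarith
      qed
      then show "\<exists>n0. \<forall>n\<ge>n0. \<forall>k\<ge>n0. vdist E (s n) (s k) < e" by blast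
    qed
    then obtain s' where s': "s' \<in> S" "(\<lambda>n. vdist E (s n) s') \<longlonglongrightarrow> 0"
      using comp s unfolding mcomplete_iff_sequences[OF metric[OF SE]] by blast
    have "vdist E (x n) (s' \<oplus> c' \<odot> a) \<le> vdist E (s n) s' + norm (c n - c') * vnorm E a" for n
    proof -
      have "s' \<in> carrier E" using s' SE by blast
      then show ?thesis
        unfolding x adj[OF s s'(1)]
        using sE[of n] a vnorm_triangle[of "s n \<ominus> s'" "(c n - c') \<odot> a"]
        by (simp add: vdist_def vnorm_smult)
    qed
    moreover have "(\<lambda>n. vdist E (s n) s' + norm (c n - c') * vnorm E a) \<longlonglongrightarrow> 0 + 0 * vnorm E a"
      using c' by (intro tendsto_add s'(2) tendsto_mult tendsto_const)
        (simp add: LIM_zero_iff tendsto_norm_zero)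
    moreover have "0 \<le> vdist E (x n) (s' \<oplus> c' \<odot> a)" for n
      by (rule Metric_space.nonneg[OF Metric_space_vdist])
    ultimately have "(\<lambda>n. vdist E (x n) (s' \<oplus> c' \<odot> a)) \<longlonglongrightarrow> 0"
      by - (rule tendsto_sandwich[of "\<lambda>_. 0" _ sequentially
            "\<lambda>n. vdist E (s n) s' + norm (c n - c') * vnorm E a"], simp_all)
    then show "\<exists>l\<in>{s \<oplus> c \<odot> a |s c. s \<in> S}. (\<lambda>n. vdist E (x n) l) \<longlonglongrightarrow> 0"
      using s' by blast
  qed
qed

lemma lin_span_insert:
  assumes B: "finite B" "B \<subseteq> carrier E" and a: "a \<in> carrier E"
  shows "lin_span (insert a B) = {s \<oplus> c \<odot> a |s c. s \<in> lin_span B}" (is "_ = ?T")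
proof
  have S: "submodule (lin_span B) scalars E" using B by (rule submodule_lin_span)
  have SE: "lin_span B \<subseteq> carrier E" by (rule subspD(1)[OF S])
  have "submodule ?T scalars E"
  proof (rule subspI)
    show "?T \<subseteq> carrier E" using SE a by auto
    show "\<zero> \<in> ?T"
      using subspD(2)[OF S] a by (intro CollectI exI[of _ \<zero>] exI[of _ 0]) simp
    fix x y assume "x \<in> ?T" "y \<in> ?T"
    then obtain s c t b where st: "s \<in> lin_span B" "t \<in> lin_span B"
      and xy: "x = s \<oplus> c \<odot> a" "y = t \<oplus> b \<odot> a" by blast
    have "s \<in> carrier E" "t \<in> carrier E" using st SE by auto
    then have "x \<oplus> y = (s \<oplus> t) \<oplus> (c + b) \<odot> a"
      using a by (simp add: xy scal_add_left a_ac)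
    then show "x \<oplus> y \<in> ?T" using subspD(3)[OF S st] by blast
  next
    fix k x assume "x \<in> ?T"
    then obtain s c where s: "s \<in> lin_span B" and x: "x = s \<oplus> c \<odot> a" by blast
    have "s \<in> carrier E" using s SE by auto
    then have "k \<odot> x = k \<odot> s \<oplus> (k * c) \<odot> a"
      using a by (simp add: x scal_add_right scal_scal)
    then show "k \<odot> x \<in> ?T" using subspD(4)[OF S s] by blast
  qed
  moreover have "insert a B \<subseteq> ?T"
  proof -
    have "a = \<zero> \<oplus> 1 \<odot> a" using a by simp
    moreover have "b = b \<oplus> 0 \<odot> a" if "b \<in> B" for b using that a B by auto
    ultimately show ?thesis using subspD(2)[OF S] lin_span_superset[OF B] by blast
  qed
  ultimately show "lin_span (insert a B) \<subseteq> ?T" by (rule lin_span_least)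
next
  have B': "finite (insert a B)" "insert a B \<subseteq> carrier E" using B a by auto
  note S = submodule_lin_span[OF B']
  have "lin_span B \<subseteq> lin_span (insert a B)" "a \<in> lin_span (insert a B)"
    using lin_span_least[OF S] lin_span_superset[OF B'] by auto
  then show "?T \<subseteq> lin_span (insert a B)" using subspD(3,4)[OF S] by blast
qed

text \<open>
  A span of finitely many vectors is reached from the zero space by adjoining one vector at a time.
\<close>

lemma mcomplete_lin_span:
  assumes "finite B" "B \<subseteq> carrier E"
  shows "Metric_space.mcomplete (lin_span B) (vdist E)"
  using assms
proof (induction B)
  case empty
  have "lin_span {} = {\<zero>}" by (auto simp: lin_span_def)
  moreover have "Metric_space {\<zero>} (vdist E)"
    using Metric_space.subspace[OF Metric_space_vdist, of "{\<zero>}"] by simp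
  moreover have "vdist E \<zero> \<zero> = 0" by (simp add: vdist_def diff_eq_zero_iff[THEN iffD2])
  ultimately show ?case by (simp add: mcomplete_iff_sequences image_subset_iff)
next
  case (insert a B)
  show ?case
  proof (cases "a \<in> lin_span B")
    case True
    have "lin_span (insert a B) \<subseteq> lin_span B"
      using insert True by (intro lin_span_least submodule_lin_span) (auto dest: lin_span_superset)
    moreover have "lin_span B \<subseteq> lin_span (insert a B)"
      using insert lin_span_superset[of "insert a B"]
      by (intro lin_span_least submodule_lin_span) auto
    ultimately show ?thesis using insert by auto
  next
    case False
    have B: "finite B" "B \<subseteq> carrier E" "a \<in> carrier E" using insert by auto
    show ?thesis
      unfolding lin_span_insert[OF B]
      using insert B False by (intro mcomplete_adjoin submodule_lin_span) simp_all
  qed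
qed

lemma banach_space_fd:
  assumes "S \<in> fd_subspaces E"
  shows "banach_space (subsp E S)"
proof -
  have S: "submodule S scalars E" using assms by (rule fd_subspaces_submodule)
  interpret S: normed_space "subsp E S" by (rule normed_space_subsp[OF S])
  have m1: "Metric_space S (vdist (subsp E S))" using S.Metric_space_vdist by simp
  have m2: "Metric_space S (vdist E)"
    using Metric_space.subspace[OF Metric_space_vdist subspD(1)[OF S]] .
  have "Metric_space.mcomplete S (vdist E)"
    using assms mcomplete_lin_span by (auto simp: fd_subspaces_iff)
  then have "Metric_space.mcomplete S (vdist (subsp E S))"
    unfolding mcomplete_iff_sequences[OF m1] mcomplete_iff_sequences[OF m2]
    by (simp add: vdist_subsp[OF S] range_subsetD)
  then show ?thesis
    by (simp add: banach_space_def banach_space_axioms_def S.normed_space_axioms)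
qed

end

section \<open>Multilinear forms and polynomials in finitely many coordinates\<close>

context normed_space
begin

lemma multilinear_form_add:
  assumes "multilinear_form m E A" "v \<in> {..<m} \<rightarrow>\<^sub>E carrier E" "i < m"
    "x \<in> carrier E" "y \<in> carrier E"
  shows "A (v(i := x \<oplus> y)) = A (v(i := x)) + A (v(i := y))"
  using assms unfolding multilinear_form_def by blast

lemma multilinear_form_scal:
  assumes "multilinear_form m E A" "v \<in> {..<m} \<rightarrow>\<^sub>E carrier E" "i < m" "x \<in> carrier E"
  shows "A (v(i := c \<odot> x)) = c * A (v(i := x))"
  using assms unfolding multilinear_form_def by blast

lemma multilinear_form_finsum:
  assumes "multilinear_form m E A" "v \<in> {..<m} \<rightarrow>\<^sub>E carrier E" "i < m"
    "finite J" "w \<in> J \<rightarrow> carrier E"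
  shows "A (v(i := finsum E w J)) = (\<Sum>j\<in>J. A (v(i := w j)))"
  using assms(4,5)
proof (induction J)
  case empty
  have "A (v(i := \<zero>)) = 0"
    using multilinear_form_scal[OF assms(1-3), of \<zero> 0] by simp
  then show ?case by (simp only: finsum_empty sum.empty)
next
  case (insert j J)
  then have w: "w j \<in> carrier E" "w \<in> J \<rightarrow> carrier E" by auto
  have "A (v(i := finsum E w (insert j J))) = A (v(i := w j)) + A (v(i := finsum E w J))"
    unfolding finsum_insert[OF insert.hyps w(2,1)]
    using w by (intro multilinear_form_add[OF assms(1-3)] finsum_closed)
  with insert.IH[OF w(2)] show ?case by (simp only: sum.insert[OF insert.hyps])
qed

text \<open>
  The index functions \<open>\<sigma>\<close> choose one summand in each slot. Polarization uses this formula for sums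
  of vectors, and \<open>polynomials_finitely_spanned\<close> uses it for coordinate expansions.
\<close>

lemma multilinear_form_expand:
  assumes A: "multilinear_form m E A" and J: "finite J"
    and w: "\<And>i j. i < m \<Longrightarrow> j \<in> J \<Longrightarrow> w i j \<in> carrier E"
  shows "A (\<lambda>i\<in>{..<m}. \<Oplus>j\<in>J. w i j) = (\<Sum>\<sigma>\<in>{..<m} \<rightarrow>\<^sub>E J. A (\<lambda>i\<in>{..<m}. w i (\<sigma> i)))"
proof -
  define u where "u i = (\<Oplus>j\<in>J. w i j)" for i
  have u: "u i \<in> carrier E" if "i < m" for i
    unfolding u_def using w that by (intro finsum_closed) auto
  \<comment> \<open>Only the first \<open>k\<close> slots are expanded, by induction on \<open>k\<close>.\<close>
  have "A (\<lambda>i\<in>{..<m}. u i) =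
      (\<Sum>\<sigma>\<in>{..<k} \<rightarrow>\<^sub>E J. A (\<lambda>i\<in>{..<m}. if i < k then w i (\<sigma> i) else u i))" if "k \<le> m" for k
    using that
  proof (induction k)
    case 0
    then show ?case by (simp add: PiE_empty_domain)
  next
    case (Suc k)
    then have k: "k < m" by simp
    define v where "v \<sigma> = (\<lambda>i\<in>{..<m}. if i < k then w i (\<sigma> i) else u i)" for \<sigma>
    have v: "v \<sigma> \<in> {..<m} \<rightarrow>\<^sub>E carrier E" if "\<sigma> \<in> {..<k} \<rightarrow>\<^sub>E J" for \<sigma>
      unfolding v_def using that w u by (auto simp: PiE_iff)
    have upd: "(v \<sigma>)(k := w k j) =
        (\<lambda>i\<in>{..<m}. if i < Suc k then w i ((\<sigma>(k := j)) i) else u i)" for \<sigma> j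
      using k by (intro ext) (auto simp: v_def less_Suc_eq)
    have inj: "inj_on (\<lambda>(y, g). g(k := y)) (J \<times> ({..<k} \<rightarrow>\<^sub>E J))"
      using inj_combinator[of k "{..<k}" "\<lambda>_. J"] by simp
    have "A (\<lambda>i\<in>{..<m}. u i) = (\<Sum>\<sigma>\<in>{..<k} \<rightarrow>\<^sub>E J. A (v \<sigma>))"
      unfolding v_def by (rule Suc.IH[OF less_imp_le[OF k]])
    also have "\<dots> = (\<Sum>\<sigma>\<in>{..<k} \<rightarrow>\<^sub>E J. \<Sum>j\<in>J. A ((v \<sigma>)(k := w k j)))"
    proof (rule sum.cong[OF refl])
      fix \<sigma> assume \<sigma>: "\<sigma> \<in> {..<k} \<rightarrow>\<^sub>E J"
      have "v \<sigma> = (v \<sigma>)(k := u k)" using k by (auto simp: v_def)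
      then have "A (v \<sigma>) = A ((v \<sigma>)(k := u k))" by simp
      also have "\<dots> = (\<Sum>j\<in>J. A ((v \<sigma>)(k := w k j)))"
        unfolding u_def using v[OF \<sigma>] k J w by (intro multilinear_form_finsum[OF A]) auto
      finally show "A (v \<sigma>) = \<dots>" .
    qed
    also have "\<dots> = (\<Sum>(j, \<sigma>)\<in>J \<times> ({..<k} \<rightarrow>\<^sub>E J). A ((v \<sigma>)(k := w k j)))"
      by (subst sum.swap) (simp add: sum.cartesian_product)
    also have "\<dots> = (\<Sum>(j, \<sigma>)\<in>J \<times> ({..<k} \<rightarrow>\<^sub>E J).
        A (\<lambda>i\<in>{..<m}. if i < Suc k then w i ((\<sigma>(k := j)) i) else u i))"
      by (simp only: upd)
    also have "\<dots> = (\<Sum>\<sigma>\<in>(\<lambda>(y, g). g(k := y)) ` (J \<times> ({..<k} \<rightarrow>\<^sub>E J)).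
        A (\<lambda>i\<in>{..<m}. if i < Suc k then w i (\<sigma> i) else u i))"
      by (subst sum.reindex[OF inj]) (simp add: case_prod_unfold)
    also have "(\<lambda>(y, g). g(k := y)) ` (J \<times> ({..<k} \<rightarrow>\<^sub>E J)) = {..<Suc k} \<rightarrow>\<^sub>E J"
      by (simp add: lessThan_Suc PiE_insert_eq)
    finally show ?case .
  qed
  from this[of m] show ?thesis
    by (simp add: u_def cong: restrict_cong)
qed

lemma multilinear_form_scal_all:
  assumes A: "multilinear_form m E A" and x: "\<And>i. i < m \<Longrightarrow> x i \<in> carrier E"
  shows "A (\<lambda>i\<in>{..<m}. c i \<odot> x i) = (\<Prod>i<m. c i) * A (\<lambda>i\<in>{..<m}. x i)"
proof -
  have "A (\<lambda>i\<in>{..<m}. if i < k then c i \<odot> x i else x i) = (\<Prod>i<k. c i) * A (\<lambda>i\<in>{..<m}. x i)"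
    if "k \<le> m" for k
    using that
  proof (induction k)
    case 0
    then show ?case by simp
  next
    case (Suc k)
    define v where "v = (\<lambda>i\<in>{..<m}. if i < k then c i \<odot> x i else x i)"
    have v: "v \<in> {..<m} \<rightarrow>\<^sub>E carrier E" using x by (auto simp: v_def)
    have eq: "(\<lambda>i\<in>{..<m}. if i < Suc k then c i \<odot> x i else x i) = v(k := c k \<odot> x k)" "v(k := x k) = v"
      using Suc.prems by (auto simp: v_def fun_eq_iff)
    have "A (v(k := c k \<odot> x k)) = c k * A v"
      using multilinear_form_scal[OF A v, of k "x k" "c k"] x Suc.prems eq(2) by simp
    also have "A v = (\<Prod>i<k. c i) * A (\<lambda>i\<in>{..<m}. x i)"
      unfolding v_def using Suc.prems by (intro Suc.IH) simp
    finally show ?case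
      by (simp only: eq(1) prod.lessThan_Suc mult.assoc mult.left_commute)
  qed
  from this[of m] show ?thesis by (simp cong: restrict_cong)
qed

text \<open>
  The functions \<open>f i\<close> are the monomials of degree \<open>m\<close> in the coordinates with respect to a finite
  spanning set, one for each sequence of \<open>m\<close> spanning vectors.
\<close>

lemma polynomials_finitely_spanned:
  assumes "finite_dim E"
  obtains I :: "(nat \<Rightarrow> 'v) set" and f where "finite I"
    "\<And>p. p \<in> carrier (polynomials m E) \<Longrightarrow> \<exists>a. \<forall>x\<in>carrier E. p x = (\<Sum>i\<in>I. a i * f i x)"
proof -
  obtain B where B: "finite B" "B \<subseteq> carrier E"
    and "\<forall>x\<in>carrier E. \<exists>c. x = (\<Oplus>b\<in>B. c b \<odot> b)"
    using assms by (auto simp: finite_dim_def)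
  then obtain c where c: "\<And>x. x \<in> carrier E \<Longrightarrow> x = (\<Oplus>b\<in>B. c x b \<odot> b)" by metis
  define I where "I = {..<m} \<rightarrow>\<^sub>E B"
  define f where "f \<sigma> x = (\<Prod>i<m. c x (\<sigma> i))" for \<sigma> x
  have "finite I" unfolding I_def using B by (intro finite_PiE) auto
  moreover have "\<exists>a. \<forall>x\<in>carrier E. p x = (\<Sum>i\<in>I. a i * f i x)"
    if "p \<in> carrier (polynomials m E)" for p
  proof -
    obtain A where A: "multilinear_form m E A" and p: "\<forall>x\<in>carrier E. p x = A (\<lambda>i\<in>{..<m}. x)"
      using \<open>p \<in> _\<close> by (auto simp: polynomials_def continuous_polynomial_def)
    have "p x = (\<Sum>\<sigma>\<in>I. A (\<lambda>i\<in>{..<m}. \<sigma> i) * f \<sigma> x)" if x: "x \<in> carrier E" for x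
    proof -
      have "p x = A (\<lambda>i\<in>{..<m}. \<Oplus>b\<in>B. c x b \<odot> b)" using p x c[OF x] by simp
      also have "\<dots> = (\<Sum>\<sigma>\<in>I. A (\<lambda>i\<in>{..<m}. c x (\<sigma> i) \<odot> \<sigma> i))"
        unfolding I_def using B by (intro multilinear_form_expand[OF A]) auto
      also have "\<dots> = (\<Sum>\<sigma>\<in>I. A (\<lambda>i\<in>{..<m}. \<sigma> i) * f \<sigma> x)"
      proof (rule sum.cong[OF refl])
        fix \<sigma> assume "\<sigma> \<in> I"
        then have "\<sigma> i \<in> carrier E" if "i < m" for i using B that by (auto simp: I_def)
        then show "A (\<lambda>i\<in>{..<m}. c x (\<sigma> i) \<odot> \<sigma> i) = A (\<lambda>i\<in>{..<m}. \<sigma> i) * f \<sigma> x"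
          using multilinear_form_scal_all[OF A, of \<sigma> "\<lambda>i. c x (\<sigma> i)"] by (simp add: f_def)
      qed
      finally show ?thesis .
    qed
    then show ?thesis by (intro exI[of _ "\<lambda>\<sigma>. A (\<lambda>i\<in>{..<m}. \<sigma> i)"]) blast
  qed
  ultimately show ?thesis by (rule that)
qed

end

text \<open>
  A finite-dimensional space of functions has interpolation nodes \<open>S\<close> and interpolating functions
  \<open>L\<close> in the space itself. The proof removes one dimension at a time: pick a node \<open>s\<close> at which some member does not
  vanish, and pass to the subspace of the functions that vanish at \<open>s\<close>. That subspace needs one spanning
  function less, because the relation \<open>p(s) = 0\<close> eliminates one coefficient.
\<close>

lemma evaluation_basis:
  fixes V :: "('a \<Rightarrow> 'k::field) set"
  assumes "finite I"
    and "\<And>p. p \<in> V \<Longrightarrow> \<exists>a. \<forall>x\<in>D. p x = (\<Sum>i\<in>I. a i * f i x)"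
    and "\<And>p r c. p \<in> V \<Longrightarrow> r \<in> V \<Longrightarrow> (\<lambda>x\<in>D. p x + c * r x) \<in> V"
  shows "\<exists>S L. finite S \<and> S \<subseteq> D \<and> L ` S \<subseteq> V \<and>
    (\<forall>p\<in>V. \<forall>x\<in>D. p x = (\<Sum>s\<in>S. p s * L s x))"
  using assms
proof (induction "card I" arbitrary: I f V rule: less_induct)
  case less
  show ?case
  proof (cases "\<forall>p\<in>V. \<forall>x\<in>D. p x = 0")
    case True
    then show ?thesis by (intro exI[of _ "{}"]) simp
  next
    case False
    then obtain p0 s where p0: "p0 \<in> V" and s: "s \<in> D" "p0 s \<noteq> 0" by blast
    obtain a where "p0 s = (\<Sum>i\<in>I. a i * f i s)" using less.prems(2)[OF p0] s by blast
    with s obtain k where k: "k \<in> I" "f k s \<noteq> 0"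
      by (metis (no_types, lifting) mult_zero_right sum.neutral)
    define V' where "V' = {p \<in> V. p s = 0}"
    \<comment> \<open>The relation \<open>p(s) = 0\<close> expresses the coefficient of \<open>f k\<close> through the others.\<close>
    define f' where "f' i x = f i x - f i s / f k s * f k x" for i x
    have spanned: "\<exists>a. \<forall>x\<in>D. p x = (\<Sum>i\<in>I - {k}. a i * f' i x)" if p: "p \<in> V'" for p
    proof -
      obtain a where a: "\<forall>x\<in>D. p x = (\<Sum>i\<in>I. a i * f i x)"
        using p less.prems(2) by (auto simp: V'_def)
      have split: "(\<Sum>i\<in>I. a i * f i x) = a k * f k x + (\<Sum>i\<in>I - {k}. a i * f i x)" for x
        using less.prems(1) k(1) by (rule sum.remove)
      have "p s = 0" using p by (simp add: V'_def)
      then have 0: "(\<Sum>i\<in>I - {k}. a i * f i s) = - (a k * f k s)"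
        using a s(1) split[of s] by (simp add: eq_neg_iff_add_eq_0 add.commute)
      have "p x = (\<Sum>i\<in>I - {k}. a i * f' i x)" if "x \<in> D" for x
      proof -
        have "(\<Sum>i\<in>I - {k}. a i * f' i x) =
            (\<Sum>i\<in>I - {k}. a i * f i x) - (\<Sum>i\<in>I - {k}. a i * f i s) / f k s * f k x"
          by (simp add: f'_def sum_subtractf right_diff_distrib sum_divide_distrib sum_distrib_right
              mult.assoc)
        also have "\<dots> = a k * f k x + (\<Sum>i\<in>I - {k}. a i * f i x)"
          unfolding 0 using k(2) by simp
        finally show ?thesis using a that split by simp
      qed
      then show ?thesis by blast
    qed
    have closed: "(\<lambda>x\<in>D. p x + c * r x) \<in> V'" if "p \<in> V'" "r \<in> V'" for p r c
      using that less.prems(3) s(1) by (simp add: V'_def)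
    have smaller: "card (I - {k}) < card I" "finite (I - {k})"
      using less.prems(1) k(1) by (rule card_Diff1_less) (use less.prems(1) in simp)
    have "\<exists>S L. finite S \<and> S \<subseteq> D \<and> L ` S \<subseteq> V' \<and>
        (\<forall>p\<in>V'. \<forall>x\<in>D. p x = (\<Sum>s\<in>S. p s * L s x))"
      using smaller spanned closed by (rule less.hyps)
    then obtain S L where S: "finite S" "S \<subseteq> D" "L ` S \<subseteq> V'"
      and SL: "\<forall>p\<in>V'. \<forall>x\<in>D. p x = (\<Sum>t\<in>S. p t * L t x)"
      by meson
    \<comment> \<open>The function \<open>p0\<close> rescaled to the value 1 at \<open>s\<close>, written so that the closure property of \<open>V\<close> applies.\<close>
    define p1 where "p1 = (\<lambda>x\<in>D. p0 x + (1 / p0 s - 1) * p0 x)"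
    have p1: "p1 \<in> V" unfolding p1_def by (rule less.prems(3)[OF p0 p0])
    have p1s: "p1 s = 1" using s by (simp add: p1_def algebra_simps)
    \<comment> \<open>Subtracting the interpolant of \<open>p1\<close> at the old nodes gives the interpolating function of the new node.\<close>
    define L0 where "L0 T = (\<lambda>x\<in>D. p1 x + (\<Sum>t\<in>T. - p1 t * L t x))" for T
    have "L0 T \<in> V" if "finite T" "T \<subseteq> S" for T
      using that
    proof (induction T)
      case empty
      have "L0 {} = p1" by (simp add: L0_def p1_def fun_eq_iff)
      with p1 show ?case by simp
    next
      case (insert t T)
      then have "L0 T \<in> V" "L t \<in> V" using S(3) by (auto simp: V'_def)
      then have "(\<lambda>x\<in>D. L0 T x + (- p1 t) * L t x) \<in> V" by (rule less.prems(3))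
      also have "(\<lambda>x\<in>D. L0 T x + (- p1 t) * L t x) = L0 (insert t T)"
        using insert by (auto simp: L0_def fun_eq_iff)
      finally show ?case .
    qed
    then have L0: "L0 (S - {s}) \<in> V" using S(1) by blast
    \<comment> \<open>The node \<open>s\<close> may occur among the old nodes, but there it contributes nothing, since all of \<open>V'\<close> vanishes at \<open>s\<close>.\<close>
    define K where "K t = (if t = s then L0 (S - {s}) else L t)" for t
    have "p x = (\<Sum>t\<in>insert s (S - {s}). p t * K t x)" if p: "p \<in> V" and x: "x \<in> D" for p x
    proof -
      define r where "r = (\<lambda>x\<in>D. p x + (- p s) * p1 x)"
      have "r \<in> V" unfolding r_def by (rule less.prems(3)[OF p p1])
      moreover have "r s = 0" using s(1) p1s by (simp add: r_def)
      ultimately have r: "r \<in> V'" by (simp add: V'_def)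
      have "r x = (\<Sum>t\<in>S. r t * L t x)" using SL r x by blast
      also have "\<dots> = (\<Sum>t\<in>S - {s}. r t * L t x)"
        using S(1) r by (intro sum.mono_neutral_right) (auto simp: V'_def)
      also have "\<dots> = (\<Sum>t\<in>S - {s}. p t * L t x + p s * (- p1 t * L t x))"
        using S(2) by (intro sum.cong) (auto simp: r_def algebra_simps)
      also have "\<dots> = (\<Sum>t\<in>S - {s}. p t * L t x) + p s * (\<Sum>t\<in>S - {s}. - p1 t * L t x)"
        by (simp only: sum.distrib sum_distrib_left)
      finally have "p x = p s * (p1 x + (\<Sum>t\<in>S - {s}. - p1 t * L t x)) + (\<Sum>t\<in>S - {s}. p t * L t x)"
        using x by (simp add: r_def algebra_simps)
      also have "\<dots> = p s * K s x + (\<Sum>t\<in>S - {s}. p t * K t x)"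
        using x by (simp add: K_def L0_def)
      also have "\<dots> = (\<Sum>t\<in>insert s (S - {s}). p t * K t x)"
        using S(1) by (subst sum.insert) simp_all
      finally show ?thesis .
    qed
    moreover have "K ` insert s (S - {s}) \<subseteq> V" using L0 S(3) by (auto simp: K_def V'_def)
    ultimately show ?thesis
      using S(1,2) s(1) by (intro exI[of _ "insert s (S - {s})"] exI[of _ K]) auto
  qed
qed

section \<open>Restriction, evaluation and pointwise limits in a normed ideal\<close>

lemma scalar_space_simps [simp]:
  "carrier scalar_space = range Inl" "\<zero>\<^bsub>scalar_space\<^esub> = Inl 0"
  "x \<oplus>\<^bsub>scalar_space\<^esub> y = Inl (projl x + projl y)" "c \<odot>\<^bsub>scalar_space\<^esub> x = Inl (c * projl x)"
  "vnorm scalar_space x = norm (projl x)"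
  by (simp_all add: scalar_space_def)

text \<open>
  The scalar field is complete because it is a Heine-Borel space.
\<close>

lemma banach_space_scalar_space:
  "banach_space (scalar_space :: ('k::{real_normed_field,heine_borel}, 'k + 'u) nspace)" (is "banach_space ?K")
proof -
  have "abelian_group ?K"
    by (rule abelian_groupI) (auto simp: algebra_simps intro: exI[of _ "- x" for x])
  then have "Module.module scalars ?K"
    by (intro moduleI cring_scalars) (auto simp: algebra_simps)
  then interpret K: normed_space ?K
    by (auto simp: normed_space_def normed_space_axioms_def norm_mult norm_triangle_ineq)
  have dist: "vdist ?K (Inl a) (Inl b) = dist a b" for a b :: 'k
    by (simp add: vdist_def K.diff_eq_scal dist_norm)
  have "\<exists>x\<in>range Inl. (\<lambda>n. vdist ?K (\<sigma> n) x) \<longlonglongrightarrow> 0"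
    if range: "range \<sigma> \<subseteq> range Inl"
      and Cauchy: "\<forall>e>0. \<exists>n0. \<forall>n\<ge>n0. \<forall>k\<ge>n0. vdist ?K (\<sigma> n) (\<sigma> k) < e"
    for \<sigma> :: "nat \<Rightarrow> 'k + 'u"
  proof -
    define z where "z n = projl (\<sigma> n)" for n
    have z: "\<sigma> n = Inl (z n)" for n
    proof -
      have "\<sigma> n \<in> range Inl" using range by blast
      then show ?thesis by (auto simp: z_def)
    qed
    have "Cauchy z" using Cauchy unfolding Cauchy_def z dist by blast
    then obtain l where "z \<longlonglongrightarrow> l" using Cauchy_convergent_iff convergent_def by blast
    then have "(\<lambda>n. vdist ?K (\<sigma> n) (Inl l)) \<longlonglongrightarrow> 0"
      using tendsto_dist_iff[of z l] by (simp only: z dist)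
    then show ?thesis by blast
  qed
  moreover have "Metric_space (range Inl) (vdist ?K)" using K.Metric_space_vdist by simp
  ultimately have "Metric_space.mcomplete (carrier ?K) (vdist ?K)"
    by (simp add: mcomplete_iff_sequences)
  then show ?thesis
    by (simp add: banach_space_def banach_space_axioms_def K.normed_space_axioms)
qed

lemma (in normed_space) op_norm_bounds:
  assumes "\<And>x. x \<in> carrier E \<Longrightarrow> 0 \<le> vnorm F (T x)"
    and "\<And>x. x \<in> carrier E \<Longrightarrow> vnorm F (T x) \<le> C * vnorm E x" and "C \<ge> 0"
  shows "0 \<le> op_norm E F T" "op_norm E F T \<le> C"
proof -
  let ?B = "{x \<in> carrier E. vnorm E x \<le> 1}"
  have zero: "\<zero> \<in> ?B" by simp
  have le: "vnorm F (T x) \<le> C" if "x \<in> ?B" for x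
    using assms(2)[of x] that mult_left_le[of "vnorm E x" C] \<open>C \<ge> 0\<close> by simp
  then have "bdd_above ((\<lambda>x. vnorm F (T x)) ` ?B)" by (intro bdd_aboveI2)
  then have "vnorm F (T \<zero>) \<le> op_norm E F T"
    unfolding op_norm_def using zero by (intro cSUP_upper)
  then show "0 \<le> op_norm E F T" using assms(1)[of \<zero>] by simp
  show "op_norm E F T \<le> C"
    unfolding op_norm_def using zero le by (intro cSUP_least) auto
qed

lemma (in normed_space) polynomial_homogeneous:
  assumes "q \<in> carrier (polynomials m E)" "x \<in> carrier E"
  shows "q (c \<odot> x) = c ^ m * q x"
proof -
  obtain A where A: "multilinear_form m E A" and q: "\<forall>x\<in>carrier E. q x = A (\<lambda>i\<in>{..<m}. x)"
    using assms(1) by (auto simp: polynomials_def continuous_polynomial_def)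
  then show ?thesis
    using multilinear_form_scal_all[OF A, of "\<lambda>_. x" "\<lambda>_. c"] assms(2) by simp
qed

context normed_ideal
begin

lemma mem_polynomials:
  assumes "banach_space E" "q \<in> Q E"
  shows "q \<in> carrier (polynomials m E)"
  using subgroup.subset[OF submodule.axioms(1)[OF subspace[OF assms(1)]]] assms(2) by auto

lemma add_scaled_mem_norm:
  assumes E: "banach_space E" and p: "p \<in> Q E" and r: "r \<in> Q E"
  shows "(\<lambda>x\<in>carrier E. p x + c * r x) \<in> Q E"
    and "N E (\<lambda>x\<in>carrier E. p x + c * r x) \<le> N E p + norm c * N E r"
proof -
  let ?W = "(polynomials m E)\<lparr>carrier := Q E, vnorm := N E\<rparr>"
  interpret W: normed_space ?W using E by (rule norm)
  have cr: "c \<odot>\<^bsub>?W\<^esub> r \<in> carrier ?W" by (rule W.scal_closed) (simp add: r)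
  have eq: "p \<oplus>\<^bsub>?W\<^esub> (c \<odot>\<^bsub>?W\<^esub> r) = (\<lambda>x\<in>carrier E. p x + c * r x)"
    by (auto simp: polynomials_def fun_eq_iff)
  show "(\<lambda>x\<in>carrier E. p x + c * r x) \<in> Q E"
    using W.a_closed[OF _ cr, of p] p unfolding eq by simp
  show "N E (\<lambda>x\<in>carrier E. p x + c * r x) \<le> N E p + norm c * N E r"
    using W.vnorm_triangle[OF _ cr, of p] W.vnorm_smult[of r c] p r unfolding eq by simp
qed

lemma norm_nonneg: "banach_space E \<Longrightarrow> q \<in> Q E \<Longrightarrow> 0 \<le> N E q"
  using normed_space.vnorm_nonneg[OF norm, of E q] by simp

lemma zero_mem_norm:
  assumes "banach_space E"
  shows "(\<lambda>x\<in>carrier E. 0) \<in> Q E" "N E (\<lambda>x\<in>carrier E. 0) = 0"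
proof -
  let ?W = "(polynomials m E)\<lparr>carrier := Q E, vnorm := N E\<rparr>"
  interpret W: normed_space ?W using assms by (rule norm)
  have "\<zero>\<^bsub>?W\<^esub> = (\<lambda>x\<in>carrier E. 0)" by (simp add: polynomials_def)
  then show "(\<lambda>x\<in>carrier E. 0) \<in> Q E" "N E (\<lambda>x\<in>carrier E. 0) = 0"
    using W.zero_closed W.vnorm_zero by simp_all
qed

lemma norm_scaled:
  assumes E: "banach_space E" and r: "r \<in> Q E"
  shows "N E (\<lambda>x\<in>carrier E. c * r x) = norm c * N E r"
proof -
  let ?W = "(polynomials m E)\<lparr>carrier := Q E, vnorm := N E\<rparr>"
  interpret W: normed_space ?W using E by (rule norm)
  show ?thesis using W.vnorm_smult[of r c] r by (simp add: polynomials_def)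
qed

text \<open>
  Interpolation formulas are linear combinations; the norm estimate is what makes the
  ideal norm Lipschitz in the values at the nodes.
\<close>

lemma lincomb_mem_norm:
  assumes E: "banach_space E" and "finite S" "L ` S \<subseteq> Q E"
  shows "(\<lambda>x\<in>carrier E. \<Sum>s\<in>S. a s * L s x) \<in> Q E \<and>
    N E (\<lambda>x\<in>carrier E. \<Sum>s\<in>S. a s * L s x) \<le> (\<Sum>s\<in>S. norm (a s) * N E (L s))"
  using assms(2,3)
proof (induction S)
  case empty
  have "N E (\<lambda>x\<in>carrier E. 0) \<le> 0" using zero_mem_norm(2)[OF E] by simp
  with zero_mem_norm(1)[OF E] show ?case unfolding sum.empty by (rule conjI)
next
  case (insert s S)
  let ?p = "\<lambda>S. \<lambda>x\<in>carrier E. \<Sum>s\<in>S. a s * L s x"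
  have "?p (insert s S) = (\<lambda>x\<in>carrier E. ?p S x + a s * L s x)"
    using insert.hyps by (auto simp: fun_eq_iff)
  moreover have L: "L ` S \<subseteq> Q E" "L s \<in> Q E" using insert.prems by auto
  moreover note p = conjunct1[OF insert.IH[OF L(1)]] L(2) conjunct2[OF insert.IH[OF L(1)]]
  ultimately have "?p (insert s S) \<in> Q E" "N E (?p (insert s S)) \<le> N E (?p S) + norm (a s) * N E (L s)"
    using add_scaled_mem_norm[OF E p(1,2), of "a s"] by (simp_all only:)
  moreover from this(2) p(3)
  have "N E (?p (insert s S)) \<le> (\<Sum>s\<in>insert s S. norm (a s) * N E (L s))"
    unfolding sum.insert[OF insert.hyps] by linarith
  ultimately show ?case by (intro conjI)
qed

text \<open>
  Restriction is composition with the inclusion, an operator of norm at most one (of norm zero if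
  \<open>S\<close> is the zero space).
\<close>

lemma restrict_mem_norm:
  assumes S: "banach_space (subsp X S)" and T: "banach_space (subsp X T)" and "S \<subseteq> T"
    and q: "q \<in> Q (subsp X T)"
  shows "restrict q S \<in> Q (subsp X S)" "N (subsp X S) (restrict q S) \<le> N (subsp X T) q"
proof -
  interpret S: banach_space "subsp X S" by (rule S)
  let ?I = "\<lambda>x. x"
  have bounded: "bounded_op (subsp X S) (subsp X T) ?I"
    using \<open>S \<subseteq> T\<close> by (auto simp: bounded_op_def linear_op_def intro!: exI[of _ 1])
  have eq: "compose (carrier (subsp X S)) q ?I = restrict q S"
    by (simp add: compose_def)
  have "0 \<le> vnorm (subsp X T) x" if "x \<in> S" for x using S.vnorm_nonneg[of x] that by simp
  then have op: "0 \<le> op_norm (subsp X S) (subsp X T) ?I" "op_norm (subsp X S) (subsp X T) ?I \<le> 1"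
    using S.op_norm_bounds[of "subsp X T" ?I 1] by simp_all
  show "restrict q S \<in> Q (subsp X S)"
    using compose_mem[OF S T bounded q] unfolding eq .
  have "N (subsp X S) (restrict q S) \<le> op_norm (subsp X S) (subsp X T) ?I ^ m * N (subsp X T) q"
    using compose_norm[OF S T bounded q] unfolding eq .
  also have "\<dots> \<le> 1 ^ m * N (subsp X T) q"
    using op norm_nonneg[OF T q] by (intro mult_right_mono power_mono)
  finally show "N (subsp X S) (restrict q S) \<le> N (subsp X T) q" by simp
qed

text \<open>
  Composing \<open>q\<close> with \<open>z \<mapsto> z x\<close> gives \<open>z \<mapsto> q(x) z\<^sup>m\<close>, whose norm in the ideal is \<open>\<bar>q(x)\<bar>\<close> by the
  normalization of the ideal norm. This holds for \<open>m = 0\<close> and \<open>x = 0\<close> as well, with \<open>0\<^sup>0 = 1\<close>.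
\<close>

lemma norm_eval_le:
  assumes E: "banach_space E" and q: "q \<in> Q E" and x: "x \<in> carrier E"
  shows "norm (q x) \<le> vnorm E x ^ m * N E q"
proof -
  interpret E: banach_space E by (rule E)
  let ?K = "scalar_space :: ('k, 'k + 'u) nspace"
  interpret K: banach_space ?K by (rule banach_space_scalar_space)
  define T where "T z = projl z \<odot>\<^bsub>E\<^esub> x" for z :: "'k + 'u"
  define pow where "pow = (\<lambda>z\<in>carrier ?K. projl z ^ m)"
  have T: "vnorm E (T z) = vnorm E x * vnorm ?K z" for z
    by (simp add: T_def E.vnorm_smult x)
  have bounded: "bounded_op ?K E T"
    unfolding bounded_op_def linear_op_def
    using x T by (auto simp: T_def E.scal_add_left E.scal_scal intro!: exI[of _ "vnorm E x"])
  have op: "0 \<le> op_norm ?K E T" "op_norm ?K E T \<le> vnorm E x"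
    using K.op_norm_bounds[of E T "vnorm E x"] T E.vnorm_nonneg[OF x] by simp_all
  have "compose (carrier ?K) q T = (\<lambda>z\<in>carrier ?K. q x * pow z)"
    using E.polynomial_homogeneous[OF mem_polynomials[OF E q] x]
    by (auto simp: compose_def T_def pow_def fun_eq_iff)
  moreover have "N ?K (\<lambda>z\<in>carrier ?K. q x * pow z) = norm (q x)"
    using norm_scaled[OF banach_space_scalar_space, of pow "q x"] power_mem power_norm
    unfolding pow_def by simp
  ultimately have "norm (q x) \<le> op_norm ?K E T ^ m * N E q"
    using compose_norm[OF banach_space_scalar_space E bounded q] by simp
  also have "\<dots> \<le> vnorm E x ^ m * N E q"
    using op norm_nonneg[OF E q] by (intro mult_right_mono power_mono)
  finally show ?thesis .
qed

text \<open>
  With the interpolation formula, membership of a restriction in the ideal becomes a family of linear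
  equations between values of the function, and its norm becomes a continuous function of finitely many
  values. Both give closed conditions in the topology of pointwise convergence.
\<close>

lemma closed_norm_le:
  assumes E: "banach_space E" and fd: "finite_dim E"
  shows "closed {f. restrict f (carrier E) \<in> Q E \<and> N E (restrict f (carrier E)) \<le> R}"
proof -
  interpret E: banach_space E by (rule E)
  obtain I :: "(nat \<Rightarrow> 'k + 'u) set" and f where "finite I"
    and "\<And>p. p \<in> carrier (polynomials m E) \<Longrightarrow>
      \<exists>a. \<forall>x\<in>carrier E. p x = (\<Sum>i\<in>I. a i * f i x)"
    by (rule E.polynomials_finitely_spanned[OF fd, of m]) (rule that)
  then have "\<exists>S L. finite S \<and> S \<subseteq> carrier E \<and> L ` S \<subseteq> Q E \<and>
      (\<forall>p\<in>Q E. \<forall>x\<in>carrier E. p x = (\<Sum>s\<in>S. p s * L s x))"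
    using add_scaled_mem_norm(1)[OF E] mem_polynomials[OF E] by (intro evaluation_basis[of I "Q E" "carrier E" f]) blast+
  then obtain S L where S: "finite S" "S \<subseteq> carrier E" and L: "L ` S \<subseteq> Q E"
    and basis: "\<forall>p\<in>Q E. \<forall>x\<in>carrier E. p x = (\<Sum>s\<in>S. p s * L s x)"
    by meson
  \<comment> \<open>The interpolant of an arbitrary function; the functions fixed by it on \<open>E\<close> are those whose restriction is in the ideal.\<close>
  define \<Phi> where "\<Phi> g = (\<lambda>x\<in>carrier E. \<Sum>s\<in>S. g s * L s x)" for g :: "'k + 'u \<Rightarrow> 'k"
  have \<Phi>: "\<Phi> g \<in> Q E" "N E (\<Phi> g) \<le> (\<Sum>s\<in>S. norm (g s) * N E (L s))" for g
    unfolding \<Phi>_def using lincomb_mem_norm[OF E S(1) L] by auto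
  have restrict_iff: "restrict g (carrier E) \<in> Q E \<longleftrightarrow> (\<forall>x\<in>carrier E. g x = (\<Sum>s\<in>S. g s * L s x))"
    (is "?l = ?r") for g
  proof
    assume ?l
    have "g x = (\<Sum>s\<in>S. restrict g (carrier E) s * L s x)" if "x \<in> carrier E" for x
      using bspec[OF bspec[OF basis \<open>?l\<close>] that] that by simp
    also have "(\<Sum>s\<in>S. restrict g (carrier E) s * L s x) = (\<Sum>s\<in>S. g s * L s x)" for x
      using S(2) by (intro sum.cong) auto
    finally show ?r by blast
  next
    assume ?r
    then have "restrict g (carrier E) = \<Phi> g" by (auto simp: \<Phi>_def fun_eq_iff)
    then show ?l using \<Phi> by simp
  qed
  have eq: "{f. restrict f (carrier E) \<in> Q E \<and> N E (restrict f (carrier E)) \<le> R} =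
      (\<Inter>x\<in>carrier E. {g. g x = (\<Sum>s\<in>S. g s * L s x)}) \<inter> {g. N E (\<Phi> g) \<le> R}"
  proof -
    have \<Phi>_eq: "restrict g (carrier E) = \<Phi> g" if "\<forall>x\<in>carrier E. g x = (\<Sum>s\<in>S. g s * L s x)" for g
      using that by (auto simp: \<Phi>_def fun_eq_iff)
    have "(\<forall>x\<in>carrier E. g x = (\<Sum>s\<in>S. g s * L s x)) \<and> N E (restrict g (carrier E)) \<le> R \<longleftrightarrow>
        (\<forall>x\<in>carrier E. g x = (\<Sum>s\<in>S. g s * L s x)) \<and> N E (\<Phi> g) \<le> R" for g
      by (rule conj_cong[OF refl]) (simp only: \<Phi>_eq)
    then show ?thesis unfolding restrict_iff by blast
  qed
  have lipschitz: "\<bar>N E (\<Phi> g) - N E (\<Phi> h)\<bar> \<le> (\<Sum>s\<in>S. norm (g s - h s) * N E (L s))" for g h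
  proof -
    have "N E (\<Phi> g) \<le> N E (\<Phi> h) + (\<Sum>s\<in>S. norm (g s - h s) * N E (L s))" for g h
    proof -
      let ?d = "\<Phi> (\<lambda>s. g s - h s)"
      have "\<Phi> g = (\<lambda>x\<in>carrier E. \<Phi> h x + 1 * ?d x)"
        by (auto simp: \<Phi>_def fun_eq_iff left_diff_distrib sum_subtractf)
      then have "N E (\<Phi> g) \<le> N E (\<Phi> h) + N E ?d"
        using add_scaled_mem_norm(2)[OF E \<Phi>(1) \<Phi>(1), of h 1 "\<lambda>s. g s - h s"] by simp
      then show ?thesis using \<Phi>(2)[of "\<lambda>s. g s - h s"] by linarith
    qed
    from this[of g h] this[of h g] show ?thesis by (simp add: norm_minus_commute)
  qed
  have "continuous_on UNIV (\<lambda>g. N E (\<Phi> g))"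
    unfolding continuous_on_def
  proof
    fix h :: "'k + 'u \<Rightarrow> 'k"
    have coord: "((\<lambda>g. g s) \<longlongrightarrow> h s) (at h)" for s
      using continuous_on_product_coordinates[of s, where 'b='k] by (simp add: continuous_on_def)
    have "((\<lambda>g. \<Sum>s\<in>S. norm (g s - h s) * N E (L s)) \<longlongrightarrow> (\<Sum>s\<in>S. norm (h s - h s) * N E (L s))) (at h)"
      by (intro tendsto_intros coord)
    then have lim: "((\<lambda>g. \<Sum>s\<in>S. norm (g s - h s) * N E (L s)) \<longlongrightarrow> 0) (at h)" by simp
    have "\<forall>\<^sub>F g in at h. norm (N E (\<Phi> g) - N E (\<Phi> h)) \<le> (\<Sum>s\<in>S. norm (g s - h s) * N E (L s))"
      by (rule always_eventually) (simp add: lipschitz)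
    then have "((\<lambda>g. N E (\<Phi> g) - N E (\<Phi> h)) \<longlongrightarrow> 0) (at h)"
      using lim by (rule Lim_null_comparison)
    then show "((\<lambda>g. N E (\<Phi> g)) \<longlongrightarrow> N E (\<Phi> h)) (at h)" by (rule LIM_zero_cancel)
  qed
  then have "closed {g. N E (\<Phi> g) \<le> R}" by (intro closed_Collect_le continuous_on_const)
  moreover have "closed {g. g x = (\<Sum>s\<in>S. g s * L s x)}" for x
    by (intro closed_Collect_eq continuous_intros continuous_on_product_coordinates)
  ultimately show ?thesis unfolding eq by blast
qed

end

section \<open>Polarization and continuity\<close>

text \<open>
  The permutations of the \<open>m\<close> slots, in the extensional encoding that
  \<open>multilinear_form_expand\<close> produces. Their number \<open>m!\<close> is the constant in the polarization formula.
\<close>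

definition surj_indices :: "nat \<Rightarrow> (nat \<Rightarrow> nat) set" where
  "surj_indices m = {\<sigma> \<in> {..<m} \<rightarrow>\<^sub>E {..<m}. \<sigma> ` {..<m} = {..<m}}"

lemma finite_surj_indices: "finite (surj_indices m)"
proof -
  have "finite ({..<m} \<rightarrow>\<^sub>E {..<m})" by (rule finite_PiE) auto
  then show ?thesis by (simp add: surj_indices_def)
qed

lemma card_surj_indices_pos: "card (surj_indices m) > 0"
proof -
  have "(\<lambda>i\<in>{..<m}. i) \<in> surj_indices m" by (auto simp: surj_indices_def)
  then show ?thesis using finite_surj_indices card_gt_0_iff by blast
qed

text \<open>
  Inclusion-exclusion: the sum is the expansion of the product over \<open>j < m\<close> of \<open>1 + 0\<close> for \<open>j \<in> T\<close> and
  \<open>1 - 1\<close> for \<open>j \<notin> T\<close>.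
\<close>

lemma alternating_sum_over_supersets:
  fixes T :: "nat set"
  assumes "T \<subseteq> {..<m}"
  shows "(\<Sum>S\<in>Pow {..<m}. if T \<subseteq> S then (-1) ^ card ({..<m} - S) else 0) =
    (if T = {..<m} then 1 else (0 :: 'k::comm_ring_1))"
proof -
  have "(\<Sum>S\<in>Pow {..<m}. if T \<subseteq> S then (-1) ^ card ({..<m} - S) else 0) =
      (\<Sum>S\<in>Pow {..<m}. (\<Prod>j\<in>S. 1) * (\<Prod>j\<in>{..<m} - S. if j \<in> T then 0 else - 1 :: 'k))"
  proof (rule sum.cong[OF refl])
    fix S assume "S \<in> Pow {..<m}"
    show "(if T \<subseteq> S then (-1) ^ card ({..<m} - S) else 0) =
        (\<Prod>j\<in>S. 1) * (\<Prod>j\<in>{..<m} - S. if j \<in> T then 0 else - 1 :: 'k)"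
    proof (cases "T \<subseteq> S")
      case True
      then have "(\<Prod>j\<in>{..<m} - S. if j \<in> T then 0 else - 1 :: 'k) = (\<Prod>j\<in>{..<m} - S. - 1)"
        by (intro prod.cong) auto
      then show ?thesis using True by simp
    next
      case False
      then obtain j where "j \<in> T" "j \<notin> S" by blast
      then have "(\<Prod>j\<in>{..<m} - S. if j \<in> T then 0 else - 1 :: 'k) = 0"
        using assms by (intro prod_zero) auto
      then show ?thesis using False by simp
    qed
  qed
  also have "\<dots> = (\<Prod>j<m. 1 + (if j \<in> T then 0 else - 1))"
    by (rule prod_add[symmetric]) simp
  also have "\<dots> = (if T = {..<m} then 1 else 0)"
  proof (cases "T = {..<m}")
    case True
    then show ?thesis by simp
  next
    case False
    then obtain j where "j < m" "j \<notin> T" using assms by blast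
    then have "(\<Prod>j<m. 1 + (if j \<in> T then 0 else - 1 :: 'k)) = 0"
      by (intro prod_zero) auto
    then show ?thesis using False by simp
  qed
  finally show ?thesis .
qed

context normed_space
begin

text \<open>
  Expanding all terms multilinearly, the choice \<open>\<sigma>\<close> occurs once for every \<open>S\<close> that contains its range.
  The alternating sum over these \<open>S\<close> cancels unless \<open>\<sigma>\<close> is onto.
\<close>

lemma polarization_identity:
  assumes A: "multilinear_form m E A" and v: "\<And>i. i < m \<Longrightarrow> v i \<in> carrier E"
  shows "(\<Sum>S\<in>Pow {..<m}. (-1) ^ card ({..<m} - S) * A (\<lambda>i\<in>{..<m}. \<Oplus>j\<in>S. v j)) =
    (\<Sum>\<sigma>\<in>surj_indices m. A (\<lambda>i\<in>{..<m}. v (\<sigma> i)))"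
proof -
  let ?I = "{..<m} \<rightarrow>\<^sub>E {..<m}"
  let ?A = "\<lambda>\<sigma>. A (\<lambda>i\<in>{..<m}. v (\<sigma> i))"
  have fin: "finite ?I" by (intro finite_PiE) auto
  have "(-1) ^ card ({..<m} - S) * A (\<lambda>i\<in>{..<m}. \<Oplus>j\<in>S. v j) =
      (\<Sum>\<sigma>\<in>?I. (if \<sigma> ` {..<m} \<subseteq> S then (-1) ^ card ({..<m} - S) else 0) * ?A \<sigma>)"
    if S: "S \<in> Pow {..<m}" for S
  proof -
    have "A (\<lambda>i\<in>{..<m}. \<Oplus>j\<in>S. v j) = (\<Sum>\<sigma>\<in>{..<m} \<rightarrow>\<^sub>E S. ?A \<sigma>)"
      using S v by (intro multilinear_form_expand[OF A]) (auto intro: finite_subset)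
    also have "{..<m} \<rightarrow>\<^sub>E S = {\<sigma> \<in> ?I. \<sigma> ` {..<m} \<subseteq> S}"
      using S by (auto simp: PiE_iff extensional_def)
    also have "(\<Sum>\<sigma>\<in>\<dots>. ?A \<sigma>) = (\<Sum>\<sigma>\<in>?I. if \<sigma> ` {..<m} \<subseteq> S then ?A \<sigma> else 0)"
      using fin by (rule sum.inter_filter)
    finally show ?thesis
      by (simp only: sum_distrib_left) (intro sum.cong, auto)
  qed
  then have "(\<Sum>S\<in>Pow {..<m}. (-1) ^ card ({..<m} - S) * A (\<lambda>i\<in>{..<m}. \<Oplus>j\<in>S. v j)) =
      (\<Sum>S\<in>Pow {..<m}. \<Sum>\<sigma>\<in>?I. (if \<sigma> ` {..<m} \<subseteq> S then (-1) ^ card ({..<m} - S) else 0) * ?A \<sigma>)"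
    by (rule sum.cong[OF refl])
  also have "\<dots> =
      (\<Sum>\<sigma>\<in>?I. (\<Sum>S\<in>Pow {..<m}. if \<sigma> ` {..<m} \<subseteq> S then (-1) ^ card ({..<m} - S) else 0) * ?A \<sigma>)"
    by (subst sum.swap) (simp only: sum_distrib_right)
  also have "\<dots> = (\<Sum>\<sigma>\<in>?I. if \<sigma> ` {..<m} = {..<m} then ?A \<sigma> else 0)"
  proof (rule sum.cong[OF refl])
    fix \<sigma> assume "\<sigma> \<in> ?I"
    then have "\<sigma> ` {..<m} \<subseteq> {..<m}" by auto
    from alternating_sum_over_supersets[OF this, where 'k='k]
    show "(\<Sum>S\<in>Pow {..<m}. if \<sigma> ` {..<m} \<subseteq> S then (-1) ^ card ({..<m} - S) else 0) * ?A \<sigma> =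
        (if \<sigma> ` {..<m} = {..<m} then ?A \<sigma> else 0)"
      by (simp only:) simp
  qed
  also have "\<dots> = (\<Sum>\<sigma>\<in>surj_indices m. ?A \<sigma>)"
    unfolding surj_indices_def using fin by (rule sum.inter_filter[symmetric])
  finally show ?thesis .
qed

text \<open>
  A permutation \<open>\<sigma>\<close> uses each vector in exactly one slot, so each summand is additive and homogeneous in
  each vector. The constant \<open>c\<close> stands for the normalization \<open>m!\<close>.
\<close>

lemma multilinear_form_symmetrization:
  assumes A: "multilinear_form m E A"
  shows "multilinear_form m E (\<lambda>v. (\<Sum>\<sigma>\<in>surj_indices m. A (\<lambda>i\<in>{..<m}. v (\<sigma> i))) / c)"
proof -
  \<comment> \<open>The vector with index \<open>i\<close> enters exactly the slot \<open>k\<close> with \<open>\<sigma> k = i\<close>.\<close>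
  have slot: "\<exists>k<m. \<exists>w\<in>{..<m} \<rightarrow>\<^sub>E carrier E.
      \<forall>x. (\<lambda>l\<in>{..<m}. (v(i := x)) (\<sigma> l)) = w(k := x)"
    if v: "v \<in> {..<m} \<rightarrow>\<^sub>E carrier E" and i: "i < m" and \<sigma>: "\<sigma> \<in> surj_indices m" for v i \<sigma>
  proof -
    have surj: "\<sigma> ` {..<m} = {..<m}" using \<sigma> by (simp add: surj_indices_def)
    then have inj: "inj_on \<sigma> {..<m}" by (intro eq_card_imp_inj_on) simp_all
    obtain k where k: "k < m" "\<sigma> k = i" using surj i by (metis imageE lessThan_iff)
    have "\<sigma> l = i \<longleftrightarrow> l = k" if "l < m" for l
      using inj_onD[OF inj, of l k] k that by auto
    then have "(\<lambda>l\<in>{..<m}. (v(i := x)) (\<sigma> l)) = (\<lambda>l\<in>{..<m}. v (\<sigma> l))(k := x)" for x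
      using k(1) by (intro ext) auto
    moreover have "(\<lambda>l\<in>{..<m}. v (\<sigma> l)) \<in> {..<m} \<rightarrow>\<^sub>E carrier E"
      using v surj by (auto simp: PiE_iff)
    ultimately show ?thesis using k(1) by blast
  qed
  have add: "A (\<lambda>l\<in>{..<m}. (v(i := x \<oplus> y)) (\<sigma> l)) =
      A (\<lambda>l\<in>{..<m}. (v(i := x)) (\<sigma> l)) + A (\<lambda>l\<in>{..<m}. (v(i := y)) (\<sigma> l))"
    if "v \<in> {..<m} \<rightarrow>\<^sub>E carrier E" "i < m" "x \<in> carrier E" "y \<in> carrier E" "\<sigma> \<in> surj_indices m"
    for v i x y \<sigma>
    using slot[OF that(1,2,5)] multilinear_form_add[OF A _ _ that(3,4)] by (elim exE conjE bexE) (simp only:)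
  have scal: "A (\<lambda>l\<in>{..<m}. (v(i := b \<odot> x)) (\<sigma> l)) = b * A (\<lambda>l\<in>{..<m}. (v(i := x)) (\<sigma> l))"
    if "v \<in> {..<m} \<rightarrow>\<^sub>E carrier E" "i < m" "x \<in> carrier E" "\<sigma> \<in> surj_indices m"
    for v i x b \<sigma>
    using slot[OF that(1,2,4)] multilinear_form_scal[OF A _ _ that(3)] by (elim exE conjE bexE) (simp only:)
  show ?thesis
    unfolding multilinear_form_def
  proof (intro ballI allI impI conjI)
    fix v i x y assume "v \<in> {..<m} \<rightarrow>\<^sub>E carrier E" "i < m" "x \<in> carrier E" "y \<in> carrier E"
    note add = add[OF this]
    show "(\<Sum>\<sigma>\<in>surj_indices m. A (\<lambda>l\<in>{..<m}. (v(i := x \<oplus> y)) (\<sigma> l))) / c =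
      (\<Sum>\<sigma>\<in>surj_indices m. A (\<lambda>l\<in>{..<m}. (v(i := x)) (\<sigma> l))) / c +
      (\<Sum>\<sigma>\<in>surj_indices m. A (\<lambda>l\<in>{..<m}. (v(i := y)) (\<sigma> l))) / c"
      by (subst sum.cong[OF refl add]) (simp_all only: sum.distrib add_divide_distrib)
  next
    fix v i b x assume "v \<in> {..<m} \<rightarrow>\<^sub>E carrier E" "i < m" "x \<in> carrier E"
    note scal = scal[OF this]
    show "(\<Sum>\<sigma>\<in>surj_indices m. A (\<lambda>l\<in>{..<m}. (v(i := b \<odot> x)) (\<sigma> l))) / c =
      b * ((\<Sum>\<sigma>\<in>surj_indices m. A (\<lambda>l\<in>{..<m}. (v(i := x)) (\<sigma> l))) / c)"
      by (subst sum.cong[OF refl scal]) (simp_all only: sum_distrib_left[symmetric] times_divide_eq_right)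
  qed
qed

lemma vnorm_finsum_le:
  assumes "finite J" "v \<in> J \<rightarrow> carrier E"
  shows "vnorm E (finsum E v J) \<le> (\<Sum>j\<in>J. vnorm E (v j))"
  using assms
proof (induction J)
  case (insert j J)
  then have "v j \<in> carrier E" "v \<in> J \<rightarrow> carrier E" by auto
  then show ?case
    using insert vnorm_triangle[of "v j" "finsum E v J"]
    by (simp add: finsum_insert finsum_closed)
qed simp

text \<open>
  The difference \<open>A(y,\<dots>,y) - A(x,\<dots>,x)\<close> telescopes into \<open>m\<close> terms in which one slot holds \<open>y - x\<close>, so
  \<open>q\<close> is Lipschitz on bounded sets.
\<close>

lemma continuous_if_bounded_multilinear:
  assumes A: "multilinear_form m E A"
    and bound: "\<And>v. v \<in> {..<m} \<rightarrow>\<^sub>E carrier E \<Longrightarrow> norm (A v) \<le> K * (\<Sum>j<m. vnorm E (v j)) ^ m"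
    and "K \<ge> 0" and q: "\<And>x. x \<in> carrier E \<Longrightarrow> q x = A (\<lambda>i\<in>{..<m}. x)"
  shows "continuous_map (norm_topology E) euclidean q"
proof -
  interpret M: Metric_space "carrier E" "vdist E" by (rule Metric_space_vdist)
  \<comment> \<open>Replacing \<open>h\<close> by a unit vector makes the estimate linear in the norm of \<open>h\<close>.\<close>
  have slot: "norm (A (w(k := h))) \<le> K * (m * r) ^ m * vnorm E h"
    if w: "w \<in> {..<m} \<rightarrow>\<^sub>E carrier E" "\<And>i. i < m \<Longrightarrow> vnorm E (w i) \<le> r"
      and k: "k < m" and h: "h \<in> carrier E" and r: "r \<ge> 1" for w k h and r :: real
  proof (cases "h = \<zero>")
    case True
    then show ?thesis
      using multilinear_form_scal[OF A w(1) k h, of 0] h by simp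
  next
    case False
    define t where "t = (of_real (vnorm E h) :: 'k)"
    have pos: "vnorm E h > 0" using False h vnorm_eq_0[of h] vnorm_nonneg[of h] by simp
    define u where "u = inverse t \<odot> h"
    have u: "u \<in> carrier E" "vnorm E u = 1" "h = t \<odot> u"
      using pos h by (simp_all add: u_def t_def vnorm_smult norm_inverse scal_scal)
    have wu: "w(k := u) \<in> {..<m} \<rightarrow>\<^sub>E carrier E" using w(1) k u(1) by (auto simp: PiE_iff extensional_def)
    have "vnorm E ((w(k := u)) j) \<le> r" if "j < m" for j
      using w(2)[OF that] u(2) r by simp
    then have "(\<Sum>j<m. vnorm E ((w(k := u)) j)) \<le> m * r"
      using sum_bounded_above[of "{..<m}" "\<lambda>j. vnorm E ((w(k := u)) j)" r] by simp
    moreover have "0 \<le> (\<Sum>j<m. vnorm E ((w(k := u)) j))"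
      by (intro sum_nonneg vnorm_nonneg PiE_mem[OF wu]) simp
    ultimately have "norm (A (w(k := u))) \<le> K * (m * r) ^ m"
      using bound[OF wu] \<open>K \<ge> 0\<close> by (meson mult_left_mono order_trans power_mono)
    moreover have "A (w(k := h)) = t * A (w(k := u))"
      unfolding u(3) using multilinear_form_scal[OF A w(1) k u(1)] .
    ultimately show ?thesis
      using pos by (simp add: norm_mult t_def mult.commute mult_left_mono)
  qed
  have lipschitz: "norm (q y - q x) \<le> m * (K * (m * r) ^ m * vnorm E (y \<ominus> x))"
    if x: "x \<in> carrier E" "vnorm E x \<le> r" and y: "y \<in> carrier E" "vnorm E y \<le> r" and r: "r \<ge> 1"
    for x y and r :: real
  proof -
    \<comment> \<open>The first \<open>k\<close> slots are already switched from \<open>x\<close> to \<open>y\<close>.\<close>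
    define w where "w k = (\<lambda>i\<in>{..<m}. if i < k then y else x)" for k
    have w: "w k \<in> {..<m} \<rightarrow>\<^sub>E carrier E" "\<And>i. i < m \<Longrightarrow> vnorm E (w k i) \<le> r" for k
      using x y by (auto simp: w_def)
    have step: "A (w (Suc k)) - A (w k) = A ((w k)(k := y \<ominus> x))" if k: "k < m" for k
    proof -
      have "w (Suc k) = (w k)(k := (y \<ominus> x) \<oplus> x)" "w k = (w k)(k := x)"
        using k x y by (auto simp: w_def fun_eq_iff less_Suc_eq a_minus_def a_assoc l_neg)
      then show ?thesis
        using multilinear_form_add[OF A w(1) k, of "y \<ominus> x" x] x y by (metis add_diff_cancel_right' minus_closed)
    qed
    have "w m = (\<lambda>i\<in>{..<m}. y)" "w 0 = (\<lambda>i\<in>{..<m}. x)" by (auto simp: w_def fun_eq_iff)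
    then have "q y - q x = A (w m) - A (w 0)" using q x y by simp
    also have "\<dots> = (\<Sum>k<m. A (w (Suc k)) - A (w k))" by (rule sum_lessThan_telescope[symmetric])
    also have "\<dots> = (\<Sum>k<m. A ((w k)(k := y \<ominus> x)))" by (intro sum.cong refl step) simp
    also have "norm \<dots> \<le> (\<Sum>k<m. K * (m * r) ^ m * vnorm E (y \<ominus> x))"
      using w x y r by (intro sum_norm_le slot) auto
    finally show ?thesis by simp
  qed
  have "continuous_map M.mtopology Met_TC.mtopology q"
    unfolding M.metric_continuous_map[OF Met_TC.Metric_space_axioms]
  proof (intro conjI ballI allI impI)
    fix x and e :: real assume x: "x \<in> carrier E" and e: "e > 0"
    define r where "r = vnorm E x + 1"
    define L where "L = m * (K * (m * r) ^ m)"
    have r: "r \<ge> 1" using vnorm_nonneg[OF x] by (simp add: r_def)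
    then have L: "L \<ge> 0" using \<open>K \<ge> 0\<close> by (simp add: L_def)
    define d where "d = min 1 (e / (L + 1))"
    have "dist (q x) (q y) < e" if y: "y \<in> carrier E" "vdist E x y < d" for y
    proof -
      have yx: "vnorm E (y \<ominus> x) < d" using x y vnorm_diff_commute[of x y] by (simp add: vdist_def)
      have "y = (y \<ominus> x) \<oplus> x" using x y by (simp add: a_minus_def a_assoc l_neg)
      then have "vnorm E y \<le> vnorm E (y \<ominus> x) + vnorm E x"
        using vnorm_triangle[of "y \<ominus> x" x] x y by simp
      then have "vnorm E y \<le> r" using yx by (simp add: r_def d_def)
      then have "norm (q y - q x) \<le> L * vnorm E (y \<ominus> x)"
        using lipschitz[OF x _ y(1) _ r] by (simp add: r_def L_def mult.assoc)
      also have "\<dots> \<le> L * (e / (L + 1))"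
        using yx L by (intro mult_left_mono) (auto simp: d_def)
      also have "\<dots> < e" using L e by (simp add: field_simps)
      finally show ?thesis by (simp add: dist_norm norm_minus_commute)
    qed
    moreover have "d > 0" using e L by (simp add: d_def)
    ultimately show "\<exists>\<delta>>0. \<forall>y. y \<in> carrier E \<and> vdist E x y < \<delta> \<longrightarrow> dist (q x) (q y) < e"
      by blast
  qed simp
  then show ?thesis by (simp add: norm_topology_def)
qed

text \<open>
  The polarization formula defines a candidate \<open>P\<close> for the multilinear form from \<open>q\<close> alone. Each of the
  identities required of \<open>P\<close> involves finitely many vectors, hence can be checked in a finite-dimensional subspace \<open>M\<close>;
  there \<open>P\<close> is the symmetrization of any multilinear form that represents \<open>q\<close> on \<open>M\<close>.
\<close>

lemma continuous_polynomial_if_locally: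
  assumes local: "\<And>M. M \<in> fd_subspaces E \<Longrightarrow> restrict q M \<in> carrier (polynomials m (subsp E M))"
    and bound: "\<And>x. x \<in> carrier E \<Longrightarrow> norm (q x) \<le> R * vnorm E x ^ m" and "R \<ge> 0"
  shows "continuous_polynomial m E q"
proof -
  define c where "c = (of_nat (card (surj_indices m)) :: 'k)"
  define P where "P v = (\<Sum>S\<in>Pow {..<m}. (-1) ^ card ({..<m} - S) * q (\<Oplus>j\<in>S. v j)) / c" for v
  have c: "c \<noteq> 0" using card_surj_indices_pos[of m] by (simp add: c_def)
  have local_form: "\<exists>B. multilinear_form m (subsp E M) B \<and> (\<forall>u\<in>{..<m} \<rightarrow>\<^sub>E M. P u = B u) \<and>
      (\<forall>x\<in>M. B (\<lambda>i\<in>{..<m}. x) = q x)" if M: "M \<in> fd_subspaces E" for M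
  proof -
    have sub: "submodule M scalars E" using M by (rule fd_subspaces_submodule)
    interpret M: normed_space "subsp E M" by (rule normed_space_subsp[OF sub])
    obtain A where A: "multilinear_form m (subsp E M) A" and qA: "\<And>x. x \<in> M \<Longrightarrow> q x = A (\<lambda>i\<in>{..<m}. x)"
      using local[OF M] by (auto simp: polynomials_def continuous_polynomial_def)
    define B where "B v = (\<Sum>\<sigma>\<in>surj_indices m. A (\<lambda>i\<in>{..<m}. v (\<sigma> i))) / c" for v
    have "P u = B u" if u: "u \<in> {..<m} \<rightarrow>\<^sub>E M" for u
    proof -
      have "q (\<Oplus>j\<in>S. u j) = A (\<lambda>i\<in>{..<m}. finsum (subsp E M) u S)" if "S \<in> Pow {..<m}" for S
      proof -
        have uS: "u \<in> S \<rightarrow> M" using u that by (auto simp: PiE_iff)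
        then show ?thesis
          unfolding finsum_subsp[OF sub uS] by (intro qA finsum_mem_subsp[OF sub])
      qed
      then have "P u = (\<Sum>S\<in>Pow {..<m}. (-1) ^ card ({..<m} - S) *
          A (\<lambda>i\<in>{..<m}. finsum (subsp E M) u S)) / c"
        unfolding P_def by (intro arg_cong2[of _ _ _ _ "(/)"] sum.cong refl) (simp only:)
      also have "\<dots> = B u"
        unfolding B_def using u by (subst M.polarization_identity[OF A]) auto
      finally show ?thesis .
    qed
    moreover have "multilinear_form m (subsp E M) B"
      unfolding B_def by (rule M.multilinear_form_symmetrization[OF A])
    moreover have "B (\<lambda>i\<in>{..<m}. x) = q x" if x: "x \<in> M" for x
    proof -
      have "(\<lambda>i\<in>{..<m}. (\<lambda>i\<in>{..<m}. x) (\<sigma> i)) = (\<lambda>i\<in>{..<m}. x)" if "\<sigma> \<in> surj_indices m" for \<sigma>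
        using that by (intro ext) (auto simp: surj_indices_def PiE_iff)
      then have "B (\<lambda>i\<in>{..<m}. x) = (\<Sum>\<sigma>\<in>surj_indices m. q x) / c"
        unfolding B_def qA[OF x] by (intro arg_cong2[of _ _ _ _ "(/)"] sum.cong refl) (simp only:)
      then show ?thesis using c by (simp add: c_def)
    qed
    ultimately show ?thesis by blast
  qed
  have form: "multilinear_form m E P"
    unfolding multilinear_form_def
  proof (intro ballI allI impI)
    fix v i assume v: "v \<in> {..<m} \<rightarrow>\<^sub>E carrier E" and i: "i < m"
    have P_on: "\<exists>M B. M \<in> fd_subspaces E \<and> x \<in> M \<and> y \<in> M \<and> v \<in> {..<m} \<rightarrow>\<^sub>E M \<and>
        multilinear_form m (subsp E M) B \<and> (\<forall>z\<in>M. P (v(i := z)) = B (v(i := z)))"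
      if xy: "x \<in> carrier E" "y \<in> carrier E" for x y
    proof -
      have "finite (insert x (insert y (v ` {..<m})))" "insert x (insert y (v ` {..<m})) \<subseteq> carrier E"
        using v xy by auto
      from fd_subspaces_containing[OF this] obtain M where M: "M \<in> fd_subspaces E" "x \<in> M" "y \<in> M" "v ` {..<m} \<subseteq> M"
        by auto
      obtain B where B: "multilinear_form m (subsp E M) B" "\<forall>u\<in>{..<m} \<rightarrow>\<^sub>E M. P u = B u"
        using local_form[OF M(1)] by blast
      have vM: "v \<in> {..<m} \<rightarrow>\<^sub>E M" using v M(4) by (auto simp: PiE_iff)
      then have "v(i := z) \<in> {..<m} \<rightarrow>\<^sub>E M" if "z \<in> M" for z
        using i that by (auto simp: PiE_iff extensional_def)
      with B(2) have "\<forall>z\<in>M. P (v(i := z)) = B (v(i := z))" by blast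
      with M(1-3) vM B(1) show ?thesis by (intro exI[of _ M] exI[of _ B] conjI)
    qed
    have "P (v(i := x \<oplus> y)) = P (v(i := x)) + P (v(i := y))" if "x \<in> carrier E" "y \<in> carrier E" for x y
    proof -
      obtain M B where M: "M \<in> fd_subspaces E" "x \<in> M" "y \<in> M" "v \<in> {..<m} \<rightarrow>\<^sub>E M"
        and B: "multilinear_form m (subsp E M) B" "\<forall>z\<in>M. P (v(i := z)) = B (v(i := z))"
        using P_on[OF \<open>x \<in> carrier E\<close> \<open>y \<in> carrier E\<close>] by blast
      have sub: "submodule M scalars E" using M(1) by (rule fd_subspaces_submodule)
      interpret M: normed_space "subsp E M" by (rule normed_space_subsp[OF sub])
      show ?thesis
        using M.multilinear_form_add[OF B(1), of v i x y] M i B(2) subspD(3)[OF sub M(2,3)] by simp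
    qed
    moreover have "P (v(i := b \<odot> x)) = b * P (v(i := x))" if "x \<in> carrier E" for b x
    proof -
      obtain M B where M: "M \<in> fd_subspaces E" "x \<in> M" "v \<in> {..<m} \<rightarrow>\<^sub>E M"
        and B: "multilinear_form m (subsp E M) B" "\<forall>z\<in>M. P (v(i := z)) = B (v(i := z))"
        using P_on[OF \<open>x \<in> carrier E\<close> \<open>x \<in> carrier E\<close>] by blast
      have sub: "submodule M scalars E" using M(1) by (rule fd_subspaces_submodule)
      interpret M: normed_space "subsp E M" by (rule normed_space_subsp[OF sub])
      show ?thesis
        using M.multilinear_form_scal[OF B(1), of v i x b] M i B(2) subspD(4)[OF sub M(2), of b] by simp
    qed
    ultimately show "(\<forall>x\<in>carrier E. \<forall>y\<in>carrier E. P (v(i := x \<oplus> y)) = P (v(i := x)) + P (v(i := y))) \<and>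
        (\<forall>b. \<forall>x\<in>carrier E. P (v(i := b \<odot> x)) = b * P (v(i := x)))" by blast
  qed
  have diag: "q x = P (\<lambda>i\<in>{..<m}. x)" if x: "x \<in> carrier E" for x
  proof -
    obtain M where M: "M \<in> fd_subspaces E" "x \<in> M"
      using fd_subspaces_containing[of "{x}"] x by auto
    obtain B where B: "\<forall>u\<in>{..<m} \<rightarrow>\<^sub>E M. P u = B u" "\<forall>x\<in>M. B (\<lambda>i\<in>{..<m}. x) = q x"
      using local_form[OF M(1)] by blast
    have "(\<lambda>i\<in>{..<m}. x) \<in> {..<m} \<rightarrow>\<^sub>E M" using M(2) by auto
    with B M(2) show ?thesis by simp
  qed
  \<comment> \<open>Each of the \<open>2\<^sup>m\<close> terms of the formula is at most \<open>R (\<Sum>j<m. \<parallel>v j\<parallel>)\<^sup>m\<close>.\<close>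
  define K where "K = (\<Sum>S\<in>Pow {..<m}. R) / norm c"
  have "norm (P v) \<le> K * (\<Sum>j<m. vnorm E (v j)) ^ m" if v: "v \<in> {..<m} \<rightarrow>\<^sub>E carrier E" for v
  proof -
    have pos: "0 \<le> vnorm E (v j)" if "j < m" for j using v that by (intro vnorm_nonneg) auto
    have "norm (q (\<Oplus>j\<in>S. v j)) \<le> R * (\<Sum>j<m. vnorm E (v j)) ^ m" if S: "S \<in> Pow {..<m}" for S
    proof -
      have vS: "v \<in> S \<rightarrow> carrier E" using v S by (auto simp: PiE_iff)
      have fS: "finite S" using S by (auto intro: finite_subset)
      have "vnorm E (\<Oplus>j\<in>S. v j) \<le> (\<Sum>j\<in>S. vnorm E (v j))" using fS vS by (rule vnorm_finsum_le)
      also have "\<dots> \<le> (\<Sum>j<m. vnorm E (v j))" using S pos by (intro sum_mono2) auto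
      finally have "vnorm E (\<Oplus>j\<in>S. v j) ^ m \<le> (\<Sum>j<m. vnorm E (v j)) ^ m"
        using finsum_closed[OF vS] by (intro power_mono vnorm_nonneg)
      then show ?thesis
        using bound[OF finsum_closed[OF vS]] \<open>R \<ge> 0\<close> by (meson mult_left_mono order_trans)
    qed
    then have "norm (\<Sum>S\<in>Pow {..<m}. (-1) ^ card ({..<m} - S) * q (\<Oplus>j\<in>S. v j)) \<le>
        (\<Sum>S\<in>Pow {..<m}. R * (\<Sum>j<m. vnorm E (v j)) ^ m)"
      by (intro sum_norm_le) (simp add: norm_mult norm_power)
    then have "norm (P v) \<le> (\<Sum>S\<in>Pow {..<m}. R * (\<Sum>j<m. vnorm E (v j)) ^ m) / norm c"
      unfolding P_def norm_divide by (rule divide_right_mono) simp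
    then show ?thesis by (simp add: K_def mult.assoc)
  qed
  moreover have "K \<ge> 0" unfolding K_def using \<open>R \<ge> 0\<close> by (intro divide_nonneg_nonneg sum_nonneg) auto
  ultimately have "continuous_map (norm_topology E) euclidean q"
    using diag by (intro continuous_if_bounded_multilinear[OF form])
  then show ?thesis unfolding continuous_polynomial_def using form diag by blast
qed

end

section \<open>Extension by compactness\<close>

lemma (in normed_space) fd_subspaces_directed:
  assumes "finite \<A>" "\<A> \<subseteq> fd_subspaces E"
  shows "\<exists>F\<in>fd_subspaces E. \<forall>M\<in>\<A>. M \<subseteq> F"
proof -
  have "\<forall>M\<in>\<A>. \<exists>B. finite B \<and> B \<subseteq> M \<and> (\<forall>T. submodule T scalars E \<longrightarrow> B \<subseteq> T \<longrightarrow> M \<subseteq> T)"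
  proof
    fix M assume "M \<in> \<A>"
    then have "M \<in> fd_subspaces E" using assms(2) by blast
    then obtain B where "finite B" "B \<subseteq> M" "\<And>T. submodule T scalars E \<Longrightarrow> B \<subseteq> T \<Longrightarrow> M \<subseteq> T"
      by (rule fd_subspacesE) (rule that)
    then show "\<exists>B. finite B \<and> B \<subseteq> M \<and> (\<forall>T. submodule T scalars E \<longrightarrow> B \<subseteq> T \<longrightarrow> M \<subseteq> T)"
      by (intro exI[of _ B]) blast
  qed
  then obtain B where B: "\<forall>M\<in>\<A>. finite (B M) \<and> B M \<subseteq> M \<and>
      (\<forall>T. submodule T scalars E \<longrightarrow> B M \<subseteq> T \<longrightarrow> M \<subseteq> T)"
    by (rule bchoice[THEN exE]) (rule that)
  have "M \<subseteq> carrier E" if "M \<in> \<A>" for M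
    using assms(2) that fd_subspaces_submodule subspD(1) by blast
  then have "finite (\<Union>M\<in>\<A>. B M)" "(\<Union>M\<in>\<A>. B M) \<subseteq> carrier E" using B assms(1) by blast+
  from fd_subspaces_containing[OF this] obtain F where F: "F \<in> fd_subspaces E" "(\<Union>M\<in>\<A>. B M) \<subseteq> F"
    by blast
  have "M \<subseteq> F" if "M \<in> \<A>" for M
  proof -
    have "B M \<subseteq> F" using F(2) that by blast
    then show ?thesis using B that fd_subspaces_submodule[OF F(1)] by blast
  qed
  with F(1) show ?thesis by blast
qed

text \<open>
  The sum is generated by the image of a generating set of \<open>E\<close> together with one of \<open>F\<close>.
\<close>

lemma fd_subspaces_image_add:
  assumes "normed_space Y" "normed_space X" and j: "linear_op Y X j"
    and E: "E \<in> fd_subspaces Y" and F: "F \<in> fd_subspaces X"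
  shows "j ` E <+>\<^bsub>X\<^esub> F \<in> fd_subspaces X" "j ` E \<subseteq> j ` E <+>\<^bsub>X\<^esub> F" "F \<subseteq> j ` E <+>\<^bsub>X\<^esub> F"
proof -
  interpret Y: normed_space Y by fact
  interpret X: normed_space X by fact
  let ?S = "j ` E <+>\<^bsub>X\<^esub> F"
  have sE: "submodule E scalars Y" and sF: "submodule F scalars X"
    using E F by (simp_all add: Y.fd_subspaces_submodule X.fd_subspaces_submodule)
  note E_sub = Y.subspD[OF sE] and F_sub = X.subspD[OF sF]
  have jX: "j y \<in> carrier X" if "y \<in> carrier Y" for y using j that by (auto simp: linear_op_def)
  have j_add: "j (x \<oplus>\<^bsub>Y\<^esub> y) = j x \<oplus>\<^bsub>X\<^esub> j y" if "x \<in> carrier Y" "y \<in> carrier Y" for x y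
    using j that by (auto simp: linear_op_def)
  have j_scal: "j (c \<odot>\<^bsub>Y\<^esub> y) = c \<odot>\<^bsub>X\<^esub> j y" if "y \<in> carrier Y" for c y
    using j that by (auto simp: linear_op_def)
  have j_zero: "j \<zero>\<^bsub>Y\<^esub> = \<zero>\<^bsub>X\<^esub>" using j_scal[of "\<zero>\<^bsub>Y\<^esub>" 0] jX by simp
  have S: "?S = {j e \<oplus>\<^bsub>X\<^esub> f |e f. e \<in> E \<and> f \<in> F}" by (auto simp: set_add_def')
  have eY: "e \<in> carrier Y" if "e \<in> E" for e using that E_sub(1) by blast
  have fX: "f \<in> carrier X" if "f \<in> F" for f using that F_sub(1) by blast
  show "j ` E \<subseteq> ?S"
  proof
    fix x assume "x \<in> j ` E"
    then obtain e where e: "e \<in> E" "x = j e" by blast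
    then have "x = j e \<oplus>\<^bsub>X\<^esub> \<zero>\<^bsub>X\<^esub>" using jX eY by simp
    then show "x \<in> ?S" unfolding S using e F_sub(2) by blast
  qed
  moreover show "F \<subseteq> ?S"
  proof
    fix f assume f: "f \<in> F"
    then have "f = j \<zero>\<^bsub>Y\<^esub> \<oplus>\<^bsub>X\<^esub> f" using fX j_zero by simp
    then show "f \<in> ?S" unfolding S using f E_sub(2) by blast
  qed
  moreover have "submodule ?S scalars X"
  proof (rule X.subspI)
    show "?S \<subseteq> carrier X" unfolding S using jX eY fX by auto
    have "\<zero>\<^bsub>X\<^esub> = j \<zero>\<^bsub>Y\<^esub> \<oplus>\<^bsub>X\<^esub> \<zero>\<^bsub>X\<^esub>" using j_zero by simp
    then show "\<zero>\<^bsub>X\<^esub> \<in> ?S" unfolding S using E_sub(2) F_sub(2) by blast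
    fix x y assume "x \<in> ?S" "y \<in> ?S"
    then obtain e f e' f' where xy: "x = j e \<oplus>\<^bsub>X\<^esub> f" "y = j e' \<oplus>\<^bsub>X\<^esub> f'"
      and mem: "e \<in> E" "f \<in> F" "e' \<in> E" "f' \<in> F" unfolding S by blast
    have "x \<oplus>\<^bsub>X\<^esub> y = j (e \<oplus>\<^bsub>Y\<^esub> e') \<oplus>\<^bsub>X\<^esub> (f \<oplus>\<^bsub>X\<^esub> f')"
      using mem by (simp add: xy j_add jX eY fX X.a_ac)
    then show "x \<oplus>\<^bsub>X\<^esub> y \<in> ?S" unfolding S using mem E_sub(3) F_sub(3) by blast
  next
    fix c x assume "x \<in> ?S"
    then obtain e f where x: "x = j e \<oplus>\<^bsub>X\<^esub> f" and mem: "e \<in> E" "f \<in> F" unfolding S by blast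
    have "c \<odot>\<^bsub>X\<^esub> x = j (c \<odot>\<^bsub>Y\<^esub> e) \<oplus>\<^bsub>X\<^esub> c \<odot>\<^bsub>X\<^esub> f"
      using mem by (simp add: x j_scal jX eY fX X.scal_add_right)
    then show "c \<odot>\<^bsub>X\<^esub> x \<in> ?S" unfolding S using mem E_sub(4) F_sub(4) by blast
  qed
  moreover obtain A where A: "finite A" "A \<subseteq> E"
    and E_least: "\<And>T. submodule T scalars Y \<Longrightarrow> A \<subseteq> T \<Longrightarrow> E \<subseteq> T"
    by (rule Y.fd_subspacesE[OF E]) (rule that)
  moreover obtain B where B: "finite B" "B \<subseteq> F"
    and F_least: "\<And>T. submodule T scalars X \<Longrightarrow> B \<subseteq> T \<Longrightarrow> F \<subseteq> T"
    by (rule X.fd_subspacesE[OF F]) (rule that)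
  ultimately show "?S \<in> fd_subspaces X"
  proof (intro X.fd_subspacesI[of ?S "j ` A \<union> B"])
    fix T assume T: "submodule T scalars X" and AB: "j ` A \<union> B \<subseteq> T"
    note T_sub = X.subspD[OF T]
    have "submodule {y \<in> carrier Y. j y \<in> T} scalars Y"
      using T_sub by (intro Y.subspI) (auto simp: j_zero j_add j_scal)
    then have "E \<subseteq> {y \<in> carrier Y. j y \<in> T}" using AB A(2) eY by (intro E_least) auto
    moreover have "F \<subseteq> T" using AB by (intro F_least[OF T]) auto
    ultimately show "?S \<subseteq> T" unfolding S using T_sub(3) by blast
  qed auto
qed

theorem theorem5:
  fixes m :: nat
    and Q :: "('k::{real_normed_field,heine_borel}, 'k + 'u) nspace \<Rightarrow> ('k + 'u \<Rightarrow> 'k) set"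
    and N :: "('k, 'k + 'u) nspace \<Rightarrow> ('k + 'u \<Rightarrow> 'k) \<Rightarrow> real"
    and X Y :: "('k, 'k + 'u) nspace"
    and j :: "'k + 'u \<Rightarrow> 'k + 'u"
    and q :: "'k + 'u \<Rightarrow> 'k"
  assumes "normed_ideal m Q N"
    and "banach_space X" and "banach_space Y"
    and "linear_embedding Y X j"
    and "q \<in> Q Y"
    and "symmetric_local_extension Q N Y X j q"
  shows "\<exists>q'\<in>max_envelope m N X. compose (carrier Y) q' j = q"
proof -
  interpret normed_ideal m Q N by fact
  interpret X: banach_space X by fact
  interpret Y: banach_space Y by fact
  have j: "linear_op Y X j" using assms(4) by (simp add: linear_embedding_def)
  have jX: "j y \<in> carrier X" if "y \<in> carrier Y" for y using j that by (auto simp: linear_op_def)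
  note sum_fd = fd_subspaces_image_add[OF Y.normed_space_axioms X.normed_space_axioms j]
  obtain C where C: "\<forall>E\<in>fd_subspaces Y. \<forall>F\<in>fd_subspaces X.
      \<exists>p\<in>Q (subsp X (j ` E <+>\<^bsub>X\<^esub> F)). (\<forall>e\<in>E. p (j e) = q e) \<and>
        N (subsp X (j ` E <+>\<^bsub>X\<^esub> F)) p \<le> C * N (subsp Y E) (restrict q E)"
    using assms(6) unfolding symmetric_local_extension_def by (elim exE)
  \<comment> \<open>The constant \<open>C\<close> may be negative, for instance if \<open>q = 0\<close>.\<close>
  define R where "R = \<bar>C\<bar> * N Y q"
  have R: "R \<ge> 0" using norm_nonneg[OF assms(3,5)] by (simp add: R_def)
  have extension: "\<exists>M p. M \<in> fd_subspaces X \<and> j ` E \<subseteq> M \<and> F \<subseteq> M \<and> p \<in> Q (subsp X M) \<and>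
      (\<forall>e\<in>E. p (j e) = q e) \<and> N (subsp X M) p \<le> R"
    if E: "E \<in> fd_subspaces Y" and F: "F \<in> fd_subspaces X" for E F
  proof -
    let ?M = "j ` E <+>\<^bsub>X\<^esub> F"
    obtain p where p: "p \<in> Q (subsp X ?M)" "\<forall>e\<in>E. p (j e) = q e"
      and N_p: "N (subsp X ?M) p \<le> C * N (subsp Y E) (restrict q E)"
      using C E F by blast
    have bE: "banach_space (subsp Y E)" using E by (rule Y.banach_space_fd)
    have "E \<subseteq> carrier Y" using Y.subspD(1)[OF Y.fd_subspaces_submodule[OF E]] .
    then have qE: "restrict q E \<in> Q (subsp Y E)" "N (subsp Y E) (restrict q E) \<le> N Y q"
      using restrict_mem_norm[OF bE, of "carrier Y" q] assms(3,5) by simp_all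
    have "C * N (subsp Y E) (restrict q E) \<le> \<bar>C\<bar> * N (subsp Y E) (restrict q E)"
      using norm_nonneg[OF bE qE(1)] by (intro mult_right_mono) auto
    also have "\<dots> \<le> R" unfolding R_def using qE(2) by (intro mult_left_mono) auto
    finally have "N (subsp X ?M) p \<le> R" using N_p by simp
    with sum_fd[OF E F] p show ?thesis by (intro exI[of _ ?M] exI[of _ p] conjI)
  qed
  define G where "G M = {f. restrict f M \<in> Q (subsp X M) \<and> N (subsp X M) (restrict f M) \<le> R}" for M
  define H where "H y = {f :: 'k + 'u \<Rightarrow> 'k. f (j y) = q y}" for y
  define I where "I = Inl ` fd_subspaces X \<union> Inr ` carrier Y"
  \<comment> \<open>The product of the balls is taken over the whole type; outside \<open>X\<close> the only value is 0.\<close>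
  define r where "r x = (if x \<in> carrier X then R * vnorm X x ^ m else 0)" for x
  define K where "K = Pi\<^sub>E UNIV (\<lambda>x. cball (0::'k) (r x))"
  have "compactin (product_topology (\<lambda>_. euclidean) UNIV) K"
    unfolding K_def compactin_PiE by simp
  then have "compact K" by (simp add: euclidean_product_topology)
  moreover have "closed (case_sum G H i)" if "i \<in> I" for i
  proof -
    have "closed (G M)" if M: "M \<in> fd_subspaces X" for M
      using closed_norm_le[OF X.banach_space_fd[OF M], of R] M by (simp add: G_def fd_subspaces_def)
    moreover have "closed (H y)" for y
      unfolding H_def by (intro closed_Collect_eq continuous_on_product_coordinates continuous_on_const)
    ultimately show ?thesis using that by (auto simp: I_def)
  qed
  moreover have "K \<inter> (\<Inter>i\<in>I'. case_sum G H i) \<noteq> {}" if I': "finite I'" "I' \<subseteq> I" for I'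
  proof -
    \<comment> \<open>Finitely many conditions are met by one local extension, for \<open>E\<close> and \<open>F\<close> large enough.\<close>
    define \<A> where "\<A> = {M. Inl M \<in> I'}"
    define B where "B = {y. Inr y \<in> I'}"
    have fin: "finite \<A>" "finite B"
      using finite_vimageI[OF I'(1), of Inl] finite_vimageI[OF I'(1), of Inr]
      by (simp_all add: \<A>_def B_def vimage_def)
    have sub: "\<A> \<subseteq> fd_subspaces X" "B \<subseteq> carrier Y"
      using I'(2) by (auto simp: \<A>_def B_def I_def)
    obtain E where E: "E \<in> fd_subspaces Y" "B \<subseteq> E"
      using Y.fd_subspaces_containing[OF fin(2) sub(2)] by (rule bexE)
    obtain F where F: "F \<in> fd_subspaces X" "\<forall>M\<in>\<A>. M \<subseteq> F"
      using X.fd_subspaces_directed[OF fin(1) sub(1)] by (rule bexE)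
    obtain M p where M: "M \<in> fd_subspaces X" "j ` E \<subseteq> M" "F \<subseteq> M" and p: "p \<in> Q (subsp X M)"
      and ext: "\<forall>e\<in>E. p (j e) = q e" and N_p: "N (subsp X M) p \<le> R"
      using extension[OF E(1) F(1)] by (elim exE conjE)
    have bM: "banach_space (subsp X M)" using M(1) by (rule X.banach_space_fd)
    have MX: "M \<subseteq> carrier X" using X.subspD(1)[OF X.fd_subspaces_submodule[OF M(1)]] .
    define f where "f x = (if x \<in> M then p x else 0)" for x
    have "norm (f x) \<le> r x" for x
    proof (cases "x \<in> M")
      case True
      then have x: "x \<in> carrier X" using MX by blast
      have "norm (p x) \<le> vnorm X x ^ m * N (subsp X M) p"
        using norm_eval_le[OF bM p] True by simp
      also have "\<dots> \<le> vnorm X x ^ m * R"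
        using N_p X.vnorm_nonneg[OF x] by (intro mult_left_mono) auto
      finally show ?thesis using True x by (simp add: f_def r_def mult.commute)
    next
      case False
      then show ?thesis using R by (simp add: f_def r_def X.vnorm_nonneg)
    qed
    then have "f \<in> K" by (simp add: K_def PiE_iff)
    moreover have "f \<in> G M'" if "M' \<in> \<A>" for M'
    proof -
      have "M' \<subseteq> M" using that F(2) M(3) by blast
      moreover from this have "restrict f M' = restrict p M'" by (auto simp: f_def fun_eq_iff)
      moreover have "banach_space (subsp X M')" using that sub(1) by (intro X.banach_space_fd) blast
      ultimately show ?thesis
        using restrict_mem_norm[OF _ bM _ p, of M'] N_p by (simp add: G_def)
    qed
    moreover have "f \<in> H y" if "y \<in> B" for y
    proof -
      have "y \<in> E" using that E(2) by blast
      then show ?thesis using M(2) ext by (auto simp: H_def f_def)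
    qed
    ultimately have "f \<in> case_sum G H i" if "i \<in> I'" for i
      using that by (cases i) (auto simp: \<A>_def B_def)
    with \<open>f \<in> K\<close> show ?thesis by blast
  qed
  ultimately have "K \<inter> (\<Inter>i\<in>I. case_sum G H i) \<noteq> {}" by (rule compact_imp_fip_image)
  then obtain f where f: "f \<in> K" "\<forall>i\<in>I. f \<in> case_sum G H i" by blast
  have f_G: "f \<in> G M" if "M \<in> fd_subspaces X" for M
    using f(2) that by (force simp: I_def)
  have f_H: "f (j y) = q y" if "y \<in> carrier Y" for y
    using f(2) that by (force simp: I_def H_def)
  define q' where "q' = restrict f (carrier X)"
  have restrict_q': "restrict q' M \<in> Q (subsp X M)" "N (subsp X M) (restrict q' M) \<le> R"
    if M: "M \<in> fd_subspaces X" for M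
  proof -
    have "M \<subseteq> carrier X" using X.subspD(1)[OF X.fd_subspaces_submodule[OF M]] .
    then have "restrict q' M = restrict f M" by (auto simp: q'_def fun_eq_iff)
    then show "restrict q' M \<in> Q (subsp X M)" "N (subsp X M) (restrict q' M) \<le> R"
      using f_G[OF M] by (simp_all add: G_def)
  qed
  have "continuous_polynomial m X q'"
  proof (rule X.continuous_polynomial_if_locally[OF _ _ R])
    show "restrict q' M \<in> carrier (polynomials m (subsp X M))" if "M \<in> fd_subspaces X" for M
      using mem_polynomials[OF X.banach_space_fd restrict_q'(1)] that by blast
    show "norm (q' x) \<le> R * vnorm X x ^ m" if "x \<in> carrier X" for x
    proof -
      have "f x \<in> cball 0 (r x)" using f(1) unfolding K_def by (rule PiE_mem) simp
      then show ?thesis using that by (simp add: r_def q'_def)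
    qed
  qed
  then have "q' \<in> carrier (polynomials m X)" by (simp add: polynomials_def q'_def)
  moreover have "max_norm N X q' \<le> ennreal R"
    unfolding max_norm_def using restrict_q'(2) by (intro SUP_least ennreal_leI)
  then have "max_norm N X q' < \<infinity>" by (rule le_less_trans) simp
  ultimately have "q' \<in> max_envelope m N X" by (simp add: max_envelope_def)
  moreover have "compose (carrier Y) q' j = q"
  proof (rule extensionalityI)
    show "compose (carrier Y) q' j \<in> extensional (carrier Y)" by simp
    show "q \<in> extensional (carrier Y)"
      using mem_polynomials[OF assms(3,5)] by (simp add: polynomials_def)
  qed (simp add: compose_eq q'_def jX f_H)
  ultimately show ?thesis by blast
qed

end
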